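(* Let $d\geq 3$ and let $\gamma:[-1,1]\to\mathbb{R}$ be Lipschitz continuous on $[-1,1]$ with ultraspherical expansion $$\gamma(t)=\sum_{k=0}^\infty a_k\,C_k^{((d-2)/2)}(t),\qquad Z_\gamma=\{k\in\mathbb{Z}_+ : a_k\neq 0\},$$ such that $Z_\gamma$ contains infinitely many odd integers as well as infinitely many even integers. Then for any distinct data points $x_1,\ldots,x_n\in\mathbb{S}^{d-1}$ the $n\times n$ matrix $H$ with entries $$H_{ij}=\frac{1}{|\mathbb{S}^{d-1}|}\int_{\mathbb{S}^{d-1}}\gamma(x_i^Tw)\,\gamma(w^Tx_j)\,dw$$ is strictly positive definite.
   Context: $\mathbb{S}^{d-1}$ is the unit sphere in $\mathbb{R}^d$, $dw$ is its surface measure and $|\mathbb{S}^{d-1}|$ its total surface measure. $C_k^{(\tau)}$ denotes the ultraspherical (Gegenbauer) polynomial of degree $k$ with parameter $\tau>0$. $\mathbb{Z}_+$ is the set of nonnegative integers. *)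

theory Defs
  imports "HOL-Analysis.Analysis"
begin

text \<open>Ultraspherical polynomials in the standard normalisation, given by
  \<open>n C\<^sub>n(t) = 2 t (n + \<tau> - 1) C\<^sub>n\<^sub>-\<^sub>1(t) - (n + 2 \<tau> - 2) C\<^sub>n\<^sub>-\<^sub>2(t)\<close>
  with \<open>n = k + 2\<close>.\<close>

fun gegenbauer :: "real \<Rightarrow> nat \<Rightarrow> real \<Rightarrow> real" where
  "gegenbauer \<tau> 0 t = 1"
| "gegenbauer \<tau> (Suc 0) t = 2 * \<tau> * t"
| "gegenbauer \<tau> (Suc (Suc k)) t =
     (2 * t * (real k + 1 + \<tau>) * gegenbauer \<tau> (Suc k) t
       - (real k + 2 * \<tau>) * gegenbauer \<tau> k t) / (real k + 2)"

text \<open>The expansion \<open>g = (\<Sum>k. a k * C\<^sub>k)\<close> is the orthogonal expansion with respect to the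
  ultraspherical weight, i.e. the series converges to \<open>g\<close> in the weighted \<open>L\<^sup>2\<close> space; for a
  merely Lipschitz \<open>g\<close> it need not converge pointwise at the end points. The integrability
  clause holds automatically for \<open>g\<close> continuous on \<open>[-1,1]\<close> and \<open>\<tau> > 0\<close>; it only
  rules out the default value \<open>0\<close> of the Bochner integral.\<close>

definition ultraspherical_expansion ::
  "real \<Rightarrow> (real \<Rightarrow> real) \<Rightarrow> (nat \<Rightarrow> real) \<Rightarrow> bool" where
  "ultraspherical_expansion \<tau> g a \<longleftrightarrow>
     (\<forall>N. set_integrable lborel {-1..1}
        (\<lambda>t. (g t - (\<Sum>k<N. a k * gegenbauer \<tau> k t))\<^sup>2 * (1 - t\<^sup>2) powr (\<tau> - 1/2))) \<and>
     (\<lambda>N. LINT t:{-1..1}|lborel.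
        (g t - (\<Sum>k<N. a k * gegenbauer \<tau> k t))\<^sup>2 * (1 - t\<^sup>2) powr (\<tau> - 1/2))
       \<longlonglongrightarrow> 0"

text \<open>Surface measure on the unit sphere as it arises from polar coordinates: the measure of a
  Borel set \<open>A\<close> is the dimension times the Lebesgue measure of the cone over \<open>A\<close>
  inside the unit ball, see \<open>emeasure_sphere_measure\<close> below.\<close>

definition sphere_measure :: "'a::euclidean_space measure" where
  "sphere_measure = scale_measure (of_nat DIM('a))
     (distr (restrict_space lborel (ball 0 1 - {0})) (restrict_space borel (sphere 0 1))
        (\<lambda>x. x /\<^sub>R norm x))"

lemma space_sphere_measure [simp]: "space sphere_measure = sphere 0 1"
  by (simp add: sphere_measure_def space_scale_measure space_restrict_space)

lemma sets_sphere_measure [simp]: "sets sphere_measure = sets (restrict_space borel (sphere 0 1))"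
  by (simp add: sphere_measure_def)

lemma emeasure_sphere_measure:
  fixes A :: "'a::euclidean_space set"
  assumes "A \<in> sets borel" "A \<subseteq> sphere 0 1"
  shows "emeasure sphere_measure A =
    of_nat DIM('a) * emeasure lborel {r *\<^sub>R w |r w. 0 < r \<and> r < 1 \<and> w \<in> A}"
proof -
  have m: "(\<lambda>x. x /\<^sub>R norm x) \<in>
      restrict_space lborel (ball 0 1 - {0}) \<rightarrow>\<^sub>M restrict_space borel (sphere (0::'a) 1)"
    by (intro measurable_restrict_space2 measurable_restrict_space1)
       (auto simp: space_restrict_space)
  have A: "A \<in> sets (restrict_space borel (sphere 0 1))"
    using assms by (auto simp: sets_restrict_space)
  have "(\<lambda>x. x /\<^sub>R norm x) -` A \<inter> (ball 0 1 - {0}) =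
      {r *\<^sub>R w |r w. 0 < r \<and> r < 1 \<and> w \<in> A}" (is "?L = ?R")
  proof (intro set_eqI iffI)
    fix x assume "x \<in> ?L"
    then have "x = norm x *\<^sub>R (x /\<^sub>R norm x)" "0 < norm x" "norm x < 1" "x /\<^sub>R norm x \<in> A"
      by auto
    then show "x \<in> ?R" by blast
  next
    fix x assume "x \<in> ?R"
    then obtain r w where x: "x = r *\<^sub>R w" "0 < r" "r < 1" "w \<in> A" by blast
    moreover have "norm w = 1" using assms x by auto
    ultimately show "x \<in> ?L" by auto
  qed
  moreover have "?R \<subseteq> ball 0 1 - {0}"
    using calculation by blast
  ultimately show ?thesis
    using m A by (simp add: sphere_measure_def emeasure_distr space_restrict_space
        emeasure_restrict_space)
qed

definition strictly_positive_definite :: "real ^ 'm ^ 'm \<Rightarrow> bool" where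
  "strictly_positive_definite H \<longleftrightarrow>
     transpose H = H \<and> (\<forall>c. c \<noteq> 0 \<longrightarrow> 0 < c \<bullet> (H *v c))"

end

theory Submission
  imports Defs
begin

text \<open>
  The quadratic form of the matrix is \<open>c \<bullet> H c = \<integral> F\<^sup>2 / |S|\<close> with
  \<open>F w = (\<Sum>i. c i * \<gamma> (x i \<bullet> w))\<close>, so it is nonnegative and the point is that \<open>\<integral> F\<^sup>2 = 0\<close>
  forces \<open>c = 0\<close>.

  The expansion of \<open>\<gamma>\<close> splits \<open>F\<close> into the zonal combinations
  \<open>P k w = (\<Sum>i. c i * C\<^sub>k (x i \<bullet> w))\<close>, weighted by \<open>a k\<close>. Different degrees are orthogonal on the
  sphere (\<open>solid_gegenbauer_orthogonal\<close>), whatever the poles are, and the weighted \<open>L\<^sup>2\<close> norm in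
  which the expansion converges is, up to a constant, the \<open>L\<^sup>2\<close> norm of zonal functions on the sphere
  (\<open>integral_sphere_zonal\<close>). By Pythagoras \<open>\<integral> F\<^sup>2 = 0\<close> therefore makes \<open>P k\<close> vanish
  identically for every \<open>k\<close> with \<open>a k \<noteq> 0\<close> (\<open>zonal_combination_components_vanish\<close>).

  Evaluate \<open>P k = 0\<close> at \<open>w = x j\<close> and divide by \<open>C\<^sub>k 1\<close>. As \<open>k\<close> grows, \<open>C\<^sub>k t / C\<^sub>k 1\<close> tends to \<open>0\<close> for
  \<open>|t| < 1\<close> (\<open>normalized_gegenbauer_tendsto_0\<close>), so only \<open>x j\<close> and its antipode survive: the limit
  along even degrees is the sum, along odd degrees the difference of their two coefficients. Both are
  \<open>0\<close>, hence \<open>c j = 0\<close> (\<open>coefficients_zero\<close>); this is where infinitely many degrees of each parity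
  are used.

  Everything about the sphere follows from one identity of integration by parts,
  \<open>integral_sphere_directional_derivative\<close>. Applied to powers of \<open>x \<bullet> w\<close> it gives the moments of
  a zonal function; applied to a product of harmonic polynomials it gives their orthogonality. It
  holds because the integral of a directional derivative of a compactly supported function on the whole
  space is \<open>0\<close>, by translation invariance of Lebesgue measure.
\<close>

section \<open>Sphere integrals of homogeneous functions\<close>

text \<open>The factor \<open>r\<close> ranges over all reals, \<open>0\<close> included, so that
  \<open>h w = norm w ^ m * h (w /\<^sub>R norm w)\<close> also holds at the origin.\<close>

definition homogeneous :: "nat \<Rightarrow> ('a::real_vector \<Rightarrow> real) \<Rightarrow> bool" where
  "homogeneous m h \<longleftrightarrow> (\<forall>r w. h (r *\<^sub>R w) = r ^ m * h w)"

text \<open>In this form the dimension factor passes through Bochner integrals by the rule for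
  densities.\<close>

lemma sphere_measure_eq_density:
  "(sphere_measure :: 'a::euclidean_space measure) = density
     (distr (restrict_space lborel (ball 0 1 - {0})) (restrict_space borel (sphere 0 1))
        (\<lambda>x. x /\<^sub>R norm x)) (\<lambda>_. ennreal (real DIM('a)))"
  unfolding sphere_measure_def
  by (rule measure_eqI) (auto simp: emeasure_density_const ennreal_of_nat_eq_real_of_nat)

lemma measurable_normalize:
  "(\<lambda>x. x /\<^sub>R norm x) \<in>
    restrict_space lborel (ball 0 1 - {0}) \<rightarrow>\<^sub>M restrict_space borel (sphere (0::'a::euclidean_space) 1)"
  by (intro measurable_restrict_space2 measurable_restrict_space1) (auto simp: space_restrict_space)

lemma bounded_on_ball:
  fixes g :: "'a::euclidean_space \<Rightarrow> real"
  assumes "continuous_on UNIV g"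
  obtains M where "0 \<le> M" "\<And>x. norm x \<le> R \<Longrightarrow> \<bar>g x\<bar> \<le> M"
proof -
  have "compact (cball (0::'a) R)" by simp
  then have "bounded (g ` cball 0 R)"
    by (intro compact_imp_bounded compact_continuous_image continuous_on_subset[OF assms]) auto
  then obtain M where M: "\<forall>x\<in>cball 0 R. \<bar>g x\<bar> \<le> M"
    unfolding bounded_real by blast
  then show ?thesis
    by (intro that[of "max M 0"]) (auto simp: le_max_iff_disj)
qed

lemma set_integrable_bounded_on_ball:
  fixes h :: "'a::euclidean_space \<Rightarrow> real"
  assumes [measurable]: "h \<in> borel_measurable borel" and M: "\<And>x. norm x < 1 \<Longrightarrow> \<bar>h x\<bar> \<le> M"
    and A: "A \<subseteq> ball 0 1" "A \<in> sets borel"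
  shows "set_integrable lborel A h"
  unfolding set_integrable_def
  by (rule integrableI_bounded_set_indicator[where B=M])
     (use M A emeasure_bounded_finite[OF bounded_subset[OF bounded_ball A(1)]] in \<open>auto simp: subset_iff\<close>)

lemma
  fixes g :: "'a::euclidean_space \<Rightarrow> real"
  assumes g: "continuous_on UNIV g"
  shows integrable_sphere_measure: "integrable sphere_measure g" (is ?i)
    and integral_sphere_measure:
      "integral\<^sup>L sphere_measure g = real DIM('a) * (LINT x:ball 0 1|lborel. g (x /\<^sub>R norm x))"
      (is ?e)
proof -
  have gm [measurable]: "g \<in> borel_measurable borel"
    using g by (rule borel_measurable_continuous_onI)
  have gm': "g \<in> borel_measurable (restrict_space borel (sphere 0 1))"
    by (rule measurable_restrict_space1) simp
  let ?B = "ball 0 1 :: 'a set"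
  let ?h = "\<lambda>x. g (x /\<^sub>R norm x)"
  obtain M where M: "\<And>x. norm x \<le> 1 \<Longrightarrow> \<bar>g x\<bar> \<le> M"
    using bounded_on_ball[OF g] by blast
  have "\<bar>?h x\<bar> \<le> M" for x
    by (rule M) (auto simp: divide_simps)
  then have int: "set_integrable lborel (?B - {0}) ?h"
    by (intro set_integrable_bounded_on_ball[where M=M]) auto
  have int': "integrable (restrict_space lborel (?B - {0})) ?h"
    using int by (simp add: integrable_restrict_space set_integrable_def)
  have id: "integrable (distr (restrict_space lborel (?B - {0})) (restrict_space borel (sphere 0 1))
        (\<lambda>x. x /\<^sub>R norm x)) g"
    using int' by (subst integrable_distr_eq[OF measurable_normalize gm'])
  show ?i
    unfolding sphere_measure_eq_density
    by (subst integrable_density) (use id gm' in auto)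
  have "integral\<^sup>L sphere_measure g = real DIM('a) * integral\<^sup>L (restrict_space lborel (?B - {0})) ?h"
    unfolding sphere_measure_eq_density
    by (subst integral_density)
       (use gm' in \<open>auto simp: integral_distr[OF measurable_normalize gm']\<close>)
  also have "integral\<^sup>L (restrict_space lborel (?B - {0})) ?h = (LINT x:?B - {0}|lborel. ?h x)"
    by (subst integral_restrict_space) (auto simp: set_lebesgue_integral_def)
  also have "\<dots> = (LINT x:?B|lborel. ?h x)"
    unfolding set_lebesgue_integral_def
    by (rule integral_cong_AE)
       (use AE_lborel_singleton[of 0] in \<open>auto elim!: eventually_mono simp: indicator_def\<close>)
  finally show ?e .
qed

lemma set_integral_ball_scale:
  fixes \<Phi> :: "'a::euclidean_space \<Rightarrow> real"
  assumes [measurable]: "\<Phi> \<in> borel_measurable borel" and q: "0 < q"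
  shows "(LINT x:ball 0 q|lborel. \<Phi> x) = q ^ DIM('a) * (LINT x:ball 0 1|lborel. \<Phi> (q *\<^sub>R x))"
proof -
  have eq: "(lborel :: 'a measure) = density (distr lborel borel (\<lambda>x. q *\<^sub>R x)) (\<lambda>_. ennreal (q ^ DIM('a)))"
    using lborel_affine[of q "0::'a"] q by simp
  have "(LINT x:ball 0 q|lborel. \<Phi> x) =
      (LINT x|density (distr lborel borel (\<lambda>x. q *\<^sub>R x)) (\<lambda>_. ennreal (q ^ DIM('a))). indicator (ball 0 q) x * \<Phi> x)"
    unfolding set_lebesgue_integral_def by (subst eq) simp
  also have "\<dots> = q ^ DIM('a) * (LINT x|lborel. indicator (ball 0 q) (q *\<^sub>R x) * \<Phi> (q *\<^sub>R x))"
  proof -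
    have [measurable]: "(\<lambda>x. indicator (ball 0 q) x * \<Phi> x) \<in> borel_measurable borel"
      by (intro borel_measurable_times borel_measurable_indicator) auto
    show ?thesis
      using q by (subst integral_density) (simp_all add: integral_distr)
  qed
  also have "(LINT x|lborel. indicator (ball 0 q) (q *\<^sub>R x) * \<Phi> (q *\<^sub>R x)) =
      (LINT x:ball 0 1|lborel. \<Phi> (q *\<^sub>R x))"
    unfolding set_lebesgue_integral_def
    using q by (intro Bochner_Integration.integral_cong) (auto simp: indicator_def)
  finally show ?thesis .
qed

text \<open>Integration in polar coordinates for homogeneous functions. Let \<open>H w = h (w /\<^sub>R norm w)\<close>. On a thin
  annulus \<open>q \<le> norm w < 1\<close> the functions \<open>h\<close> and \<open>H\<close> differ by a factor close to \<open>1\<close>, while by scaling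
  the annulus carries the fractions \<open>1 - q ^ (d + m)\<close> and \<open>1 - q ^ d\<close> of their integrals over the ball.
  Dividing by \<open>1 - q\<close> and letting \<open>q\<close> tend to \<open>1\<close> compares the two integrals over the ball.\<close>

lemma integral_sphere_measure_homogeneous:
  fixes h :: "'a::euclidean_space \<Rightarrow> real"
  assumes h: "continuous_on UNIV h" "homogeneous m h"
  shows "integral\<^sup>L sphere_measure h = (real DIM('a) + m) * (LINT x:ball 0 1|lborel. h x)"
proof -
  have hm [measurable]: "h \<in> borel_measurable borel"
    using h(1) by (rule borel_measurable_continuous_onI)
  define H where "H = (\<lambda>x. h (x /\<^sub>R norm x))"
  have Hm [measurable]: "H \<in> borel_measurable borel"
    unfolding H_def by measurable
  have hH: "h x = norm x ^ m * H x" for x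
  proof (cases "x = 0")
    case True
    then show ?thesis
      using h(2)[unfolded homogeneous_def, rule_format, of 0 0] by (simp add: H_def)
  next
    case False
    then show ?thesis
      using h(2)[unfolded homogeneous_def, rule_format, of "norm x" "x /\<^sub>R norm x"] by (simp add: H_def)
  qed
  obtain M where M: "0 \<le> M" "\<And>x. norm x \<le> 1 \<Longrightarrow> \<bar>h x\<bar> \<le> M"
    using bounded_on_ball[OF h(1)] by blast
  have MH: "\<bar>H x\<bar> \<le> M" for x
    unfolding H_def by (rule M) (auto simp: divide_simps)
  let ?n = "DIM('a)" and ?K = "LINT x:ball 0 1|lborel. h x" and ?L = "LINT x:ball 0 1|lborel. H x"
    and ?v = "measure lborel (ball (0::'a) 1)"
  have inth: "set_integrable lborel A h" and intH: "set_integrable lborel A H"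
    if "A \<subseteq> ball 0 1" "A \<in> sets borel" for A
    using that M(2) MH by (auto intro!: set_integrable_bounded_on_ball[where M=M])
  \<comment> \<open>On the annulus \<open>|h - H| = (1 - norm x ^ m) * |H| \<le> (1 - q ^ m) * M\<close>. The annulus itself has
    measure \<open>O(1 - q)\<close>, so the error is of second order in \<open>1 - q\<close>.\<close>
  have key: "\<bar>(1 - q ^ (?n + m)) * ?K - (1 - q ^ ?n) * ?L\<bar> \<le> (1 - q ^ m) * ((1 - q ^ ?n) * (M * ?v))"
    if q: "0 < q" "q < 1" for q :: real
  proof -
    let ?A = "ball 0 1 - ball 0 q :: 'a set"
    have A: "?A \<subseteq> ball 0 1" "?A \<in> sets borel" by auto
    have Bq: "ball 0 q \<subseteq> (ball 0 1 :: 'a set)" using q by auto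
    have split: "(LINT x:ball 0 1|lborel. f x) = (LINT x:ball 0 q|lborel. f x) + (LINT x:?A|lborel. f x)"
      if "\<And>A. A \<subseteq> ball 0 1 \<Longrightarrow> A \<in> sets borel \<Longrightarrow> set_integrable lborel A f" for f :: "'a \<Rightarrow> real"
    proof -
      have "ball 0 1 = ball 0 q \<union> ?A" using Bq by auto
      then show ?thesis
        using set_integral_Un[of "ball 0 q" ?A lborel f] that[OF A] that[OF Bq] by auto
    qed
    have "(LINT x:ball 0 q|lborel. h x) = q ^ (?n + m) * ?K"
      using h(2) q
      by (subst set_integral_ball_scale[of h q]) (auto simp: homogeneous_def power_add)
    then have a1: "(LINT x:?A|lborel. h x) = (1 - q ^ (?n + m)) * ?K"
      unfolding left_diff_distrib mult_1 using split[OF inth] by linarith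
    have "H (q *\<^sub>R x) = H x" for x
      using q by (simp only: H_def sgn_div_norm[symmetric] sgn_scaleR) simp
    then have "(LINT x:ball 0 q|lborel. H x) = q ^ ?n * ?L"
      using q by (subst set_integral_ball_scale[of H q]) auto
    then have a2: "(LINT x:?A|lborel. H x) = (1 - q ^ ?n) * ?L"
      unfolding left_diff_distrib mult_1 using split[OF intH] by linarith
    have bv: "measure lborel (ball (0::'a) q) = q ^ ?n * ?v"
      using set_integral_ball_scale[of "\<lambda>_::'a. 1::real" q] q
      by (simp add: set_lebesgue_integral_def)
    have a3: "measure lborel ?A = (1 - q ^ ?n) * ?v"
      using measure_Diff[of lborel "ball (0::'a) 1" "ball 0 q"] Bq bv emeasure_bounded_finite[of "ball (0::'a) 1"]
      by (auto simp: algebra_simps top.not_eq_extremum)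
    have "\<bar>(LINT x:?A|lborel. h x) - (LINT x:?A|lborel. H x)\<bar> = \<bar>LINT x:?A|lborel. h x - H x\<bar>"
      using inth[OF A] intH[OF A] by simp
    also have "\<dots> \<le> (LINT x:?A|lborel. \<bar>h x - H x\<bar>)"
      using set_integral_norm_bound[of lborel ?A "\<lambda>x. h x - H x"] inth[OF A] intH[OF A] by simp
    also have "\<dots> \<le> (LINT x:?A|lborel. (1 - q ^ m) * M)"
    proof (rule set_integral_mono)
      show "set_integrable lborel ?A (\<lambda>x. \<bar>h x - H x\<bar>)"
        by (intro set_integrable_abs set_integral_diff(1) inth intH A)
      show "set_integrable lborel ?A (\<lambda>x. (1 - q ^ m) * M)"
        using emeasure_bounded_finite[OF bounded_subset[OF bounded_ball A(1)]] 
        by (simp add: set_integrable_def)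
      fix x :: 'a assume x: "x \<in> ?A"
      have "\<bar>h x - H x\<bar> = (1 - norm x ^ m) * \<bar>H x\<bar>"
      proof -
        have "h x - H x = - ((1 - norm x ^ m) * H x)"
          unfolding hH[of x] by (simp add: algebra_simps)
        moreover have "norm x ^ m \<le> 1"
          using x by (intro power_le_one) auto
        ultimately show ?thesis by (simp add: abs_mult)
      qed
      also have "\<dots> \<le> (1 - q ^ m) * M"
        using x q MH power_mono[of q "norm x" m] M power_le_one[of "norm x" m] by (intro mult_mono) (auto simp: power_le_one)
      finally show "\<bar>h x - H x\<bar> \<le> (1 - q ^ m) * M" .
    qed
    also have "\<dots> = (1 - q ^ m) * ((1 - q ^ ?n) * (M * ?v))"
      using a3 by (simp add: set_lebesgue_integral_def)
    finally show ?thesis unfolding a1 a2 .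
  qed
  have lim: "((\<lambda>q::real. (1 - q ^ k) / (1 - q)) \<longlongrightarrow> real k) (at_left 1)" for k
  proof -
    have "((\<lambda>q::real. q ^ k) has_field_derivative real k) (at 1 within {..<1})"
      by (auto intro!: derivative_eq_intros)
    then have "((\<lambda>q::real. (q ^ k - 1) / (q - 1)) \<longlongrightarrow> real k) (at_left 1)"
      by (simp add: has_field_derivative_iff)
    moreover have "(q ^ k - 1) / (q - 1) = (1 - q ^ k) / (1 - q)" for q :: real
      by (metis minus_diff_eq minus_divide_divide)
    ultimately show ?thesis by simp
  qed
  define l where "l = (\<lambda>q. \<bar>(1 - q ^ (?n + m)) / (1 - q) * ?K - (1 - q ^ ?n) / (1 - q) * ?L\<bar>)"
  define u where "u = (\<lambda>q. (1 - q ^ m) * ((1 - q ^ ?n) / (1 - q) * (M * ?v)))"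
  have l: "(l \<longlongrightarrow> \<bar>real (?n + m) * ?K - real ?n * ?L\<bar>) (at_left 1)"
    unfolding l_def by (intro tendsto_intros lim)
  have u: "(u \<longlongrightarrow> (1 - 1 ^ m) * (real ?n * (M * ?v))) (at_left 1)"
    unfolding u_def by (intro tendsto_intros lim)
  have "\<forall>\<^sub>F q in at_left 1. l q \<le> u q"
    using eventually_at_left_real[of 0 1, OF zero_less_one]
  proof eventually_elim
    case (elim q)
    then have q: "0 < q" "q < 1" by auto
    have "l q = \<bar>(1 - q ^ (?n + m)) * ?K - (1 - q ^ ?n) * ?L\<bar> / (1 - q)"
      using q by (simp add: l_def abs_divide flip: diff_divide_distrib)
    also have "\<dots> \<le> (1 - q ^ m) * ((1 - q ^ ?n) * (M * ?v)) / (1 - q)"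
      using q by (intro divide_right_mono key) auto
    also have "\<dots> = u q"
      by (simp add: u_def)
    finally show ?case .
  qed
  from tendsto_le[OF _ u l this]
  have "\<bar>real (?n + m) * ?K - real ?n * ?L\<bar> \<le> 0" by simp
  then have "real ?n * ?L = real (?n + m) * ?K" by simp
  then show ?thesis
    using integral_sphere_measure[OF h(1)] by (simp add: H_def)
qed

section \<open>Integration by parts on the sphere\<close>

text \<open>Stated at every parameter of the line rather than at \<open>s = 0\<close> only, which is equivalent because
  \<open>w\<close> is arbitrary: in this form it feeds the mean value theorem and the chain rule directly.\<close>

definition directional_derivative :: "('a::real_vector \<Rightarrow> real) \<Rightarrow> 'a \<Rightarrow> ('a \<Rightarrow> real) \<Rightarrow> bool" where
  "directional_derivative f e f' \<longleftrightarrow>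
     (\<forall>w s. ((\<lambda>s. f (w + s *\<^sub>R e)) has_real_derivative f' (w + s *\<^sub>R e)) (at s))"

lemma integrable_bounded_support:
  fixes F :: "'a::euclidean_space \<Rightarrow> real"
  assumes F: "continuous_on UNIV F" and supp: "\<And>w. R < norm w \<Longrightarrow> F w = 0"
  shows "integrable lborel F"
proof -
  obtain M where M: "0 \<le> M" "\<And>x. norm x \<le> R \<Longrightarrow> \<bar>F x\<bar> \<le> M"
    using bounded_on_ball[OF F] by blast
  have [measurable]: "F \<in> borel_measurable borel"
    using F by (rule borel_measurable_continuous_onI)
  show ?thesis
    by (rule integrableI_bounded_set[where A="cball 0 R" and B=M])
       (use M supp emeasure_bounded_finite[of "cball (0::'a) R"] in \<open>auto simp: not_le\<close>)
qed

text \<open>The difference quotients of \<open>F\<close> in direction \<open>e\<close> have integral \<open>0\<close> by translation invariance. By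
  the mean value theorem they are values of \<open>G\<close>, hence bounded with a common bounded support, and
  dominated convergence applies.\<close>

lemma integral_directional_derivative_eq_0:
  fixes F G :: "'a::euclidean_space \<Rightarrow> real"
  assumes F: "continuous_on UNIV F" and G: "continuous_on UNIV G"
    and deriv: "directional_derivative F e G"
    and suppF: "\<And>w. R < norm w \<Longrightarrow> F w = 0" and suppG: "\<And>w. R < norm w \<Longrightarrow> G w = 0"
  shows "(LINT w|lborel. G w) = 0"
proof -
  have [measurable]: "F \<in> borel_measurable borel" "G \<in> borel_measurable borel"
    using F G by (auto intro: borel_measurable_continuous_onI)
  define h where "h = (\<lambda>n. 1 / real (Suc n))"
  have h: "0 < h n" "h n \<le> 1" for n
    by (auto simp: h_def)
  define D where "D = (\<lambda>n w. (F (h n *\<^sub>R e + w) - F w) / h n)"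
  obtain M where M: "0 \<le> M" "\<And>x. norm x \<le> R \<Longrightarrow> \<bar>G x\<bar> \<le> M"
    using bounded_on_ball[OF G] by blast
  then have M: "\<bar>G x\<bar> \<le> M" for x
    using suppG[of x] by (cases "norm x \<le> R") auto
  have intF: "integrable lborel F"
    using F suppF by (rule integrable_bounded_support)
  have trans: "(LINT w|lborel. F (c + w)) = (LINT w|lborel. F w)" "integrable lborel (\<lambda>w. F (c + w))" for c
  proof -
    show "(LINT w|lborel. F (c + w)) = (LINT w|lborel. F w)"
      by (subst lborel_distr_plus[of c, symmetric]) (simp add: integral_distr)
    show "integrable lborel (\<lambda>w. F (c + w))"
      using intF by (subst (asm) lborel_distr_plus[of c, symmetric]) (simp add: integrable_distr_eq)
  qed
  have D0: "(LINT w|lborel. D n w) = 0" for n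
    using trans[of "h n *\<^sub>R e"] intF by (simp add: D_def)
  have "(\<lambda>n. LINT w|lborel. D n w) \<longlonglongrightarrow> (LINT w|lborel. G w)"
  proof (rule integral_dominated_convergence[where w="\<lambda>w. M * indicator (cball 0 (R + norm e)) w"])
    show "integrable lborel (\<lambda>w::'a. M * indicator (cball 0 (R + norm e)) w)"
      using emeasure_bounded_finite[of "cball (0::'a) (R + norm e)"] by (intro integrable_mult_right) simp
    show "AE w in lborel. (\<lambda>n. D n w) \<longlonglongrightarrow> G w"
    proof (rule AE_I2)
      fix w
      have "((\<lambda>s. F (w + s *\<^sub>R e)) has_real_derivative G w) (at 0)"
        using deriv[unfolded directional_derivative_def, rule_format, of w 0] by simp
      then have "((\<lambda>s. (F (w + s *\<^sub>R e) - F w) / s) \<longlongrightarrow> G w) (at 0)"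
        by (simp add: has_field_derivative_iff)
      moreover have "filterlim h (at 0) sequentially"
      proof -
        have "h \<longlonglongrightarrow> 0"
          unfolding h_def using LIMSEQ_inverse_real_of_nat by (simp add: inverse_eq_divide)
        then show ?thesis
          using h(1) by (auto simp: filterlim_at intro!: always_eventually) (metis less_irrefl)
      qed
      ultimately have "(\<lambda>n. (F (w + h n *\<^sub>R e) - F w) / h n) \<longlonglongrightarrow> G w"
        by (rule filterlim_compose)
      then show "(\<lambda>n. D n w) \<longlonglongrightarrow> G w"
        by (simp add: D_def add.commute)
    qed
    show "AE w in lborel. norm (D n w) \<le> M * indicator (cball 0 (R + norm e)) w" for n
    proof (rule AE_I2)
      fix w
      show "norm (D n w) \<le> M * indicator (cball 0 (R + norm e)) w"
      proof (cases "norm w \<le> R + norm e")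
        case True
        obtain z where "F (w + h n *\<^sub>R e) - F (w + 0 *\<^sub>R e) = (h n - 0) * G (w + z *\<^sub>R e)"
          using MVT2[of 0 "h n" "\<lambda>s. F (w + s *\<^sub>R e)" "\<lambda>s. G (w + s *\<^sub>R e)"] h(1)[of n]
            deriv[unfolded directional_derivative_def, rule_format, of w] by auto
        then have "D n w = G (w + z *\<^sub>R e)"
          using h(1)[of n] by (simp add: D_def add.commute)
        then show ?thesis using M True by simp
      next
        case False
        have "norm (h n *\<^sub>R e) \<le> norm e"
          using h[of n] by (simp add: mult_left_le_one_le)
        then have "R < norm (h n *\<^sub>R e + w)"
          using False norm_triangle_ineq2[of w "- (h n *\<^sub>R e)"] by (simp add: add.commute)
        moreover have "R < norm w" using False norm_ge_zero[of e] by linarith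
        ultimately show ?thesis using False by (simp add: D_def suppF)
      qed
    qed
  qed (auto simp: D_def)
  then show ?thesis
    by (simp add: D0 LIMSEQ_const_iff)
qed

lemma has_real_derivative_positive_part_power2:
  "((\<lambda>u::real. (max 0 u)\<^sup>2) has_real_derivative 2 * max 0 u) (at u)"
proof (cases u "0::real" rule: linorder_cases)
  case less
  have "((\<lambda>u::real. 0) has_real_derivative 0) (at u)" by simp
  then show ?thesis
    using less by (rule_tac has_field_derivative_transform_within_open[of "\<lambda>_. 0" _ _ "{..<0}"]) auto
next
  case greater
  have "((\<lambda>u::real. u\<^sup>2) has_real_derivative 2 * u) (at u)"
    by (auto intro!: derivative_eq_intros)
  then show ?thesis
    using greater by (rule_tac has_field_derivative_transform_within_open[of "\<lambda>u. u\<^sup>2" _ _ "{0<..}"]) auto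
next
  case equal
  have "((\<lambda>y::real. (max 0 y)\<^sup>2 / y) \<longlongrightarrow> 0) (at 0)"
  proof (rule Lim_null_comparison)
    show "\<forall>\<^sub>F y::real in at 0. norm ((max 0 y)\<^sup>2 / y) \<le> \<bar>y\<bar>"
      by (auto simp: max_def power2_eq_square intro!: always_eventually)
    show "((\<lambda>y::real. \<bar>y\<bar>) \<longlongrightarrow> 0) (at 0)"
      by (rule tendsto_eq_intros | simp)+
  qed
  then show ?thesis
    using equal by (simp add: has_field_derivative_iff)
qed

lemma homogeneous_mult:
  "homogeneous m f \<Longrightarrow> homogeneous n g \<Longrightarrow> homogeneous (m + n) (\<lambda>w. f w * g w)"
  by (simp add: homogeneous_def power_add)

lemma homogeneous_inner [simp]: "homogeneous 1 (\<lambda>w. w \<bullet> e)"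
  by (simp add: homogeneous_def)

lemma homogeneous_norm_power2 [simp]: "homogeneous 2 (\<lambda>w. w \<bullet> w)"
  by (simp add: homogeneous_def power2_eq_square)

lemma integral_sphere_measure_cong:
  assumes "\<And>w. norm w = 1 \<Longrightarrow> f w = g w"
  shows "integral\<^sup>L sphere_measure f = integral\<^sup>L sphere_measure g"
  by (rule Bochner_Integration.integral_cong) (auto simp: assms)

text \<open>Homogeneity of degree \<open>0\<close>, taken at \<open>r = 0\<close>, makes the function constant.\<close>

lemma directional_derivative_homogeneous_0:
  assumes "directional_derivative f e f'" "homogeneous 0 f"
  shows "f' = (\<lambda>_. 0)"
proof
  fix w
  have "f v = f 0" for v
    using assms(2)[unfolded homogeneous_def, rule_format, of 0 v] by simp
  then have "(\<lambda>s. f (w + s *\<^sub>R e)) = (\<lambda>_. f 0)" by auto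
  then have "((\<lambda>_. f 0) has_real_derivative f' (w + 0 *\<^sub>R e)) (at 0)"
    using assms(1)[unfolded directional_derivative_def, rule_format, of w 0] by metis
  then show "f' w = 0"
    using DERIV_unique[OF _ DERIV_const] by fastforce
qed

text \<open>For \<open>r \<noteq> 0\<close> differentiate \<open>f (r *\<^sub>R w) = r ^ m * f w\<close>; this breaks down at \<open>r = 0\<close>, which is
  recovered from the continuity of the derivative.\<close>

lemma homogeneous_directional_derivative:
  fixes f :: "'a::real_normed_vector \<Rightarrow> real"
  assumes f': "continuous_on UNIV f'" and deriv: "directional_derivative f e f'" and hf: "homogeneous m f"
  shows "homogeneous (m - 1) f'"
proof (cases m)
  case 0
  then show ?thesis
    using directional_derivative_homogeneous_0[OF deriv] hf by (simp add: homogeneous_def)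
next
  case (Suc n)
  have nz: "f' (r *\<^sub>R w) = r ^ n * f' w" if r: "r \<noteq> 0" for r w
  proof -
    have "((\<lambda>s. f (r *\<^sub>R w + s *\<^sub>R e)) has_real_derivative f' (r *\<^sub>R w)) (at (r * 0))"
      using deriv[unfolded directional_derivative_def, rule_format, of "r *\<^sub>R w" 0] by simp
    then have "((\<lambda>s. f (r *\<^sub>R w + (r * s) *\<^sub>R e)) has_real_derivative f' (r *\<^sub>R w) * r) (at 0)"
      by (rule DERIV_chain2) (auto intro!: derivative_eq_intros)
    moreover have "(\<lambda>s. f (r *\<^sub>R w + (r * s) *\<^sub>R e)) = (\<lambda>s. r ^ m * f (w + s *\<^sub>R e))"
      using hf by (simp add: homogeneous_def flip: scaleR_scaleR scaleR_add_right)
    moreover have "((\<lambda>s. r ^ m * f (w + s *\<^sub>R e)) has_real_derivative r ^ m * f' w) (at 0)"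
      using deriv[unfolded directional_derivative_def, rule_format, of w 0] by (intro DERIV_cmult) simp
    ultimately have "f' (r *\<^sub>R w) * r = r ^ m * f' w"
      by (metis DERIV_unique)
    then show ?thesis
      using r Suc by (simp add: field_simps)
  qed
  have "f' (r *\<^sub>R w) = r ^ n * f' w" for r w
  proof (cases "r = 0")
    case True
    have "isCont (\<lambda>r. f' (r *\<^sub>R w)) 0"
      by (rule continuous_on_interior[of UNIV])
         (auto intro!: continuous_intros continuous_on_compose2[OF f'])
    then have "((\<lambda>r. f' (r *\<^sub>R w)) \<longlongrightarrow> f' (0 *\<^sub>R w)) (at 0)"
      by (simp add: isCont_def)
    moreover have "((\<lambda>r. f' (r *\<^sub>R w)) \<longlongrightarrow> 0 ^ n * f' w) (at 0)"
      by (rule Lim_transform_eventually[where f="\<lambda>r. r ^ n * f' w"])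
         (auto intro!: tendsto_intros simp: nz eventually_at_filter)
    ultimately have "f' (0 *\<^sub>R w) = 0 ^ n * f' w"
      using tendsto_unique[of "at (0::real)"] by auto
    then show ?thesis using True by simp
  qed (rule nz)
  then show ?thesis
    using Suc by (simp add: homogeneous_def)
qed

text \<open>Integration by parts on the sphere. Multiply \<open>f\<close> by a radial \<open>C\<^sup>1\<close> cut-off that vanishes outside
  the unit ball. The derivative of the product integrates to \<open>0\<close> over the whole space, and it is a
  combination of homogeneous functions whose restrictions to the sphere are \<open>f'\<close> and \<open>f w * (w \<bullet> e)\<close>.\<close>

lemma integral_sphere_directional_derivative:
  fixes f f' :: "'a::euclidean_space \<Rightarrow> real"
  assumes f: "continuous_on UNIV f" and f': "continuous_on UNIV f'"
    and deriv: "directional_derivative f e f'" and hf: "homogeneous s f"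
  shows "integral\<^sup>L sphere_measure f' =
    (real DIM('a) + real s - 1) * (LINT w|sphere_measure. f w * (w \<bullet> e))"
proof -
  let ?d = "real DIM('a)"
  note hf' = homogeneous_directional_derivative[OF f' deriv hf]
  note s0 = directional_derivative_homogeneous_0[OF deriv]
  define A where "A = integral\<^sup>L sphere_measure f'"
  define B where "B = (LINT w|sphere_measure. f w * (w \<bullet> e))"
  have d: "?d \<ge> 1" using DIM_positive[where 'a='a] by linarith
  \<comment> \<open>The square makes the cut-off continuously differentiable across the unit sphere.\<close>
  define F where "F = (\<lambda>w. f w * (max 0 (1 - w \<bullet> w))\<^sup>2)"
  define G where "G = (\<lambda>w. f' w * (max 0 (1 - w \<bullet> w))\<^sup>2 - 4 * (f w * (w \<bullet> e)) * max 0 (1 - w \<bullet> w))"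
  have out: "max 0 (1 - w \<bullet> w) = 0" if "1 \<le> norm w" for w :: 'a
    using that by (simp add: dot_square_norm)
  have G0: "(LINT w|lborel. G w) = 0"
  proof (rule integral_directional_derivative_eq_0)
    show "continuous_on UNIV F" "continuous_on UNIV G"
      unfolding F_def G_def by (intro continuous_intros f f')+
    show "directional_derivative F e G"
      unfolding directional_derivative_def
    proof (intro allI)
      fix w s
      have a: "((\<lambda>s. f (w + s *\<^sub>R e)) has_real_derivative f' (w + s *\<^sub>R e)) (at s)"
        using deriv by (simp add: directional_derivative_def)
      have b: "((\<lambda>s. 1 - (w + s *\<^sub>R e) \<bullet> (w + s *\<^sub>R e)) has_real_derivative - 2 * ((w + s *\<^sub>R e) \<bullet> e)) (at s)"
        by (simp add: inner_add_left inner_add_right)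
           (rule derivative_eq_intros refl | simp add: inner_commute)+
      show "((\<lambda>s. F (w + s *\<^sub>R e)) has_real_derivative G (w + s *\<^sub>R e)) (at s)"
        unfolding F_def
        by (rule DERIV_cong[OF DERIV_mult[OF a DERIV_chain2[OF has_real_derivative_positive_part_power2 b]]])
           (simp add: G_def algebra_simps)
    qed
    show "1 < norm w \<Longrightarrow> F w = 0" "1 < norm w \<Longrightarrow> G w = 0" for w
      by (auto simp: F_def G_def out)
  qed
  define f1 where "f1 = (\<lambda>w. (w \<bullet> w) * f' w)"
  define f2 where "f2 = (\<lambda>w. (w \<bullet> w) * f1 w)"
  define g0 where "g0 = (\<lambda>w. f w * (w \<bullet> e))"
  define g1 where "g1 = (\<lambda>w. (w \<bullet> w) * g0 w)"
  have cont: "continuous_on UNIV f1" "continuous_on UNIV f2" "continuous_on UNIV g0" "continuous_on UNIV g1"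
    unfolding f1_def f2_def g0_def g1_def by (intro continuous_intros f f')+
  have int: "set_integrable lborel (ball 0 1) h" if h: "continuous_on UNIV h" for h :: "'a \<Rightarrow> real"
  proof -
    obtain M where "\<And>x. norm x \<le> 1 \<Longrightarrow> \<bar>h x\<bar> \<le> M"
      using bounded_on_ball[OF h] by blast
    then show ?thesis
      using borel_measurable_continuous_onI[OF h]
      by (intro set_integrable_bounded_on_ball[where M=M]) auto
  qed
  have "(LINT w|lborel. G w) = (LINT w:ball 0 1|lborel. f' w - 2 * f1 w + f2 w - 4 * g0 w + 4 * g1 w)"
    unfolding set_lebesgue_integral_def
  proof (rule Bochner_Integration.integral_cong)
    fix w :: 'a
    show "G w = indicat_real (ball 0 1) w *\<^sub>R (f' w - 2 * f1 w + f2 w - 4 * g0 w + 4 * g1 w)"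
    proof (cases "norm w < 1")
      case True
      then have "norm w * norm w \<le> 1" by (intro mult_le_one) auto
      then have "max 0 (1 - w \<bullet> w) = 1 - w \<bullet> w"
        by (simp add: dot_square_norm power2_eq_square)
      then show ?thesis
        using True by (simp add: G_def f1_def f2_def g0_def g1_def algebra_simps power2_eq_square)
    qed (simp add: G_def out)
  qed simp
  also have "\<dots> = (LINT w:ball 0 1|lborel. f' w) - 2 * (LINT w:ball 0 1|lborel. f1 w) + (LINT w:ball 0 1|lborel. f2 w)
      - 4 * (LINT w:ball 0 1|lborel. g0 w) + 4 * (LINT w:ball 0 1|lborel. g1 w)"
    using int[OF f'] cont[THEN int] by simp
  finally have eq: "(LINT w:ball 0 1|lborel. f' w) - 2 * (LINT w:ball 0 1|lborel. f1 w) + (LINT w:ball 0 1|lborel. f2 w)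
      - 4 * (LINT w:ball 0 1|lborel. g0 w) + 4 * (LINT w:ball 0 1|lborel. g1 w) = 0"
    using G0 by simp
  have h0: "homogeneous (s + 1) g0"
    unfolding g0_def by (rule homogeneous_mult[OF hf homogeneous_inner])
  have h1: "homogeneous (2 + (s + 1)) g1"
    unfolding g1_def by (rule homogeneous_mult[OF homogeneous_norm_power2 h0])
  have k1: "homogeneous (2 + (s - 1)) f1"
    unfolding f1_def by (rule homogeneous_mult[OF homogeneous_norm_power2 hf'])
  have k2: "homogeneous (2 + (2 + (s - 1))) f2"
    unfolding f2_def by (rule homogeneous_mult[OF homogeneous_norm_power2 k1])
  have S: "integral\<^sup>L sphere_measure f1 = A" "integral\<^sup>L sphere_measure f2 = A"
     "integral\<^sup>L sphere_measure g0 = B" "integral\<^sup>L sphere_measure g1 = B"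
    unfolding A_def B_def
    by (auto intro!: integral_sphere_measure_cong simp: f1_def f2_def g0_def g1_def dot_square_norm)
  have g: "(LINT w:ball 0 1|lborel. g0 w) = B / (?d + s + 1)" "(LINT w:ball 0 1|lborel. g1 w) = B / (?d + s + 3)"
    using integral_sphere_measure_homogeneous[OF cont(3) h0] integral_sphere_measure_homogeneous[OF cont(4) h1] S d
    by (auto simp: field_simps)
  have "A = (?d + real s - 1) * B"
  proof (cases "s = 0")
    case True
    then have "f' = (\<lambda>_. 0)" "f1 = (\<lambda>_. 0)" "f2 = (\<lambda>_. 0)"
      using s0 hf by (auto simp: f1_def f2_def)
    then have "A = 0" "B / (?d + 3) = B / (?d + 1)"
      using eq g True by (auto simp: A_def set_lebesgue_integral_def)
    moreover from this(2) have "B = 0"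
      using d by (simp add: field_simps)
    ultimately show ?thesis by simp
  next
    case False
    define n where "n = ?d + real s - 1"
    have "real s \<ge> 1" using False by simp
    then have n: "n > 0" using d unfolding n_def by linarith
    have deg: "?d + real (s - 1) = n" "?d + real (2 + (s - 1)) = n + 2" "?d + real (2 + (2 + (s - 1))) = n + 4"
      using False by (simp_all add: n_def)
    have solve: "K = c / m" if "c = m * K" "m > 0" for K c m :: real
      using that by simp
    have f: "(LINT w:ball 0 1|lborel. f' w) = A / n" "(LINT w:ball 0 1|lborel. f1 w) = A / (n + 2)"
      "(LINT w:ball 0 1|lborel. f2 w) = A / (n + 4)"
      using integral_sphere_measure_homogeneous[OF f' hf', unfolded deg, folded A_def, THEN solve]
        integral_sphere_measure_homogeneous[OF cont(1) k1, unfolded deg S, THEN solve]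
        integral_sphere_measure_homogeneous[OF cont(2) k2, unfolded deg S, THEN solve] n
      by simp_all
    have "A / n - 2 * (A / (n + 2)) + A / (n + 4) - 4 * (B / (n + 2)) + 4 * (B / (n + 4)) = 0"
      using eq unfolding f g n_def by (simp add: algebra_simps)
    moreover have "A / n - 2 * (A / (n + 2)) + A / (n + 4) - 4 * (B / (n + 2)) + 4 * (B / (n + 4)) =
       8 * (A - n * B) / (n * (n + 2) * (n + 4))"
      using n by (simp add: divide_simps) (simp add: algebra_simps)
    ultimately have "A - n * B = 0" using n by simp
    then show ?thesis by (simp add: n_def)
  qed
  then show ?thesis by (simp add: A_def B_def)
qed

section \<open>Orthogonality of zonal harmonics\<close>

text \<open>The homogeneous polynomial \<open>norm w ^ k * C\<^sub>k ((x \<bullet> w) / norm w)\<close>, from the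
  recurrence for \<open>C\<^sub>k\<close>, with factors \<open>w \<bullet> w\<close> inserted to equalise the degrees.\<close>

fun solid_gegenbauer :: "real \<Rightarrow> 'a::real_inner \<Rightarrow> nat \<Rightarrow> 'a \<Rightarrow> real" where
  "solid_gegenbauer \<tau> x 0 w = 1"
| "solid_gegenbauer \<tau> x (Suc 0) w = 2 * \<tau> * (x \<bullet> w)"
| "solid_gegenbauer \<tau> x (Suc (Suc k)) w =
     (2 * (real k + 1 + \<tau>) * ((x \<bullet> w) * solid_gegenbauer \<tau> x (Suc k) w)
       - (real k + 2 * \<tau>) * ((w \<bullet> w) * solid_gegenbauer \<tau> x k w)) / (real k + 2)"

fun solid_gegenbauer_grad :: "real \<Rightarrow> 'a::real_inner \<Rightarrow> nat \<Rightarrow> 'a \<Rightarrow> 'a" where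
  "solid_gegenbauer_grad \<tau> x 0 w = 0"
| "solid_gegenbauer_grad \<tau> x (Suc 0) w = (2 * \<tau>) *\<^sub>R x"
| "solid_gegenbauer_grad \<tau> x (Suc (Suc k)) w =
     ((2 * (real k + 1 + \<tau>)) *\<^sub>R
         (solid_gegenbauer \<tau> x (Suc k) w *\<^sub>R x + (x \<bullet> w) *\<^sub>R solid_gegenbauer_grad \<tau> x (Suc k) w)
       - (real k + 2 * \<tau>) *\<^sub>R
         ((2 * solid_gegenbauer \<tau> x k w) *\<^sub>R w + (w \<bullet> w) *\<^sub>R solid_gegenbauer_grad \<tau> x k w))
     /\<^sub>R (real k + 2)"

text \<open>The second derivative along the line in direction \<open>e\<close>; summed over an orthonormal basis it
  becomes the Laplacian.\<close>

fun solid_gegenbauer_deriv2 :: "real \<Rightarrow> 'a::real_inner \<Rightarrow> nat \<Rightarrow> 'a \<Rightarrow> 'a \<Rightarrow> real" where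
  "solid_gegenbauer_deriv2 \<tau> x 0 e w = 0"
| "solid_gegenbauer_deriv2 \<tau> x (Suc 0) e w = 0"
| "solid_gegenbauer_deriv2 \<tau> x (Suc (Suc k)) e w =
     (2 * (real k + 1 + \<tau>) * (2 * ((x \<bullet> e) * (solid_gegenbauer_grad \<tau> x (Suc k) w \<bullet> e))
           + (x \<bullet> w) * solid_gegenbauer_deriv2 \<tau> x (Suc k) e w)
       - (real k + 2 * \<tau>) * (2 * solid_gegenbauer \<tau> x k w * (e \<bullet> e)
           + 4 * ((w \<bullet> e) * (solid_gegenbauer_grad \<tau> x k w \<bullet> e))
           + (w \<bullet> w) * solid_gegenbauer_deriv2 \<tau> x k e w)) / (real k + 2)"

lemma solid_gegenbauer_sphere:
  "norm w = 1 \<Longrightarrow> solid_gegenbauer \<tau> x k w = gegenbauer \<tau> k (x \<bullet> w)"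
  by (induction k rule: induct_nat_012) (simp_all add: dot_square_norm mult_ac)

lemma homogeneous_solid_gegenbauer: "homogeneous k (solid_gegenbauer \<tau> x k)"
proof -
  have "solid_gegenbauer \<tau> x k (r *\<^sub>R w) = r ^ k * solid_gegenbauer \<tau> x k w" for r w
    by (induction k rule: induct_nat_012) (simp_all add: algebra_simps diff_divide_distrib add_divide_distrib)
  then show ?thesis by (simp add: homogeneous_def)
qed

lemma continuous_on_solid_gegenbauer [continuous_intros]:
  "continuous_on A (\<lambda>w. solid_gegenbauer \<tau> x k w)"
  by (induction k rule: induct_nat_012) (auto intro!: continuous_intros)

lemma continuous_on_solid_gegenbauer_grad [continuous_intros]:
  "continuous_on A (\<lambda>w. solid_gegenbauer_grad \<tau> x k w)"
  by (induction k rule: induct_nat_012) (auto intro!: continuous_intros)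

lemma continuous_on_solid_gegenbauer_deriv2 [continuous_intros]:
  "continuous_on A (\<lambda>w. solid_gegenbauer_deriv2 \<tau> x k e w)"
  by (induction k rule: induct_nat_012) (auto intro!: continuous_intros)

lemma directional_derivative_solid_gegenbauer:
  "directional_derivative (solid_gegenbauer \<tau> x k) e (\<lambda>w. solid_gegenbauer_grad \<tau> x k w \<bullet> e)"
proof -
  have "((\<lambda>s. solid_gegenbauer \<tau> x k (w + s *\<^sub>R e)) has_real_derivative
      solid_gegenbauer_grad \<tau> x k (w + s *\<^sub>R e) \<bullet> e) (at s)" for w s
  proof (induction k rule: induct_nat_012)
    case 1
    have "(\<lambda>s. solid_gegenbauer \<tau> x (Suc 0) (w + s *\<^sub>R e)) = (\<lambda>s. 2 * \<tau> * (x \<bullet> w + s * (x \<bullet> e)))"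
      by (simp add: inner_add_right)
    then show ?case
      by (auto intro!: derivative_eq_intros)
  next
    case (ge2 k)
    have a: "((\<lambda>s. x \<bullet> (w + s *\<^sub>R e)) has_real_derivative x \<bullet> e) (at s)"
      unfolding inner_add_right by (auto intro!: derivative_eq_intros)
    have b: "((\<lambda>s. (w + s *\<^sub>R e) \<bullet> (w + s *\<^sub>R e)) has_real_derivative 2 * ((w + s *\<^sub>R e) \<bullet> e)) (at s)"
      by (simp add: inner_add_left inner_add_right)
         (rule derivative_eq_intros refl | simp add: inner_commute)+
    show ?case
      unfolding solid_gegenbauer.simps
      by (rule derivative_eq_intros a b ge2 refl | simp)+
         (simp add: inner_diff_left inner_add_left field_simps)
  qed simp
  then show ?thesis by (simp add: directional_derivative_def)
qed

lemma directional_derivative_solid_gegenbauer_grad: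
  "directional_derivative (\<lambda>w. solid_gegenbauer_grad \<tau> x k w \<bullet> e) e (solid_gegenbauer_deriv2 \<tau> x k e)"
proof -
  have "((\<lambda>s. solid_gegenbauer_grad \<tau> x k (w + s *\<^sub>R e) \<bullet> e) has_real_derivative
      solid_gegenbauer_deriv2 \<tau> x k e (w + s *\<^sub>R e)) (at s)" for w s
  proof (induction k rule: induct_nat_012)
    case (ge2 k)
    have a: "((\<lambda>s. x \<bullet> (w + s *\<^sub>R e)) has_real_derivative x \<bullet> e) (at s)"
      unfolding inner_add_right by (auto intro!: derivative_eq_intros)
    have a': "((\<lambda>s. (w + s *\<^sub>R e) \<bullet> e) has_real_derivative e \<bullet> e) (at s)"
      unfolding inner_add_left by (auto intro!: derivative_eq_intros)
    have b: "((\<lambda>s. (w + s *\<^sub>R e) \<bullet> (w + s *\<^sub>R e)) has_real_derivative 2 * ((w + s *\<^sub>R e) \<bullet> e)) (at s)"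
      by (simp add: inner_add_left inner_add_right)
         (rule derivative_eq_intros refl | simp add: inner_commute)+
    note c = directional_derivative_solid_gegenbauer[unfolded directional_derivative_def, rule_format]
    have eq: "solid_gegenbauer_grad \<tau> x (Suc (Suc k)) w \<bullet> e =
        (2 * (real k + 1 + \<tau>) * (solid_gegenbauer \<tau> x (Suc k) w * (x \<bullet> e)
            + (x \<bullet> w) * (solid_gegenbauer_grad \<tau> x (Suc k) w \<bullet> e))
       - (real k + 2 * \<tau>) * (2 * solid_gegenbauer \<tau> x k w * (w \<bullet> e)
            + (w \<bullet> w) * (solid_gegenbauer_grad \<tau> x k w \<bullet> e))) / (real k + 2)" for w
      by (simp add: inner_diff_left inner_add_left divide_inverse)
    show ?case
      unfolding eq
      by (rule derivative_eq_intros a a' b c ge2 refl | simp)+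
         (simp add: field_simps)
  qed simp_all
  then show ?thesis by (simp add: directional_derivative_def)
qed

lemma solid_gegenbauer_euler:
  "solid_gegenbauer_grad \<tau> x k w \<bullet> w = real k * solid_gegenbauer \<tau> x k w"
proof (induction k rule: induct_nat_012)
  case (ge2 k)
  have "(real k + 2) * (solid_gegenbauer_grad \<tau> x (Suc (Suc k)) w \<bullet> w) =
      2 * (real k + 1 + \<tau>) * (solid_gegenbauer \<tau> x (Suc k) w * (x \<bullet> w)
           + (x \<bullet> w) * (solid_gegenbauer_grad \<tau> x (Suc k) w \<bullet> w))
       - (real k + 2 * \<tau>) * (2 * solid_gegenbauer \<tau> x k w * (w \<bullet> w)
           + (w \<bullet> w) * (solid_gegenbauer_grad \<tau> x k w \<bullet> w))"
    by (subst solid_gegenbauer_grad.simps(3))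
       (simp add: inner_diff_left inner_add_left del: solid_gegenbauer_grad.simps solid_gegenbauer.simps)
  also have "\<dots> = (real k + 2) * (2 * (real k + 1 + \<tau>) * ((x \<bullet> w) * solid_gegenbauer \<tau> x (Suc k) w)
       - (real k + 2 * \<tau>) * ((w \<bullet> w) * solid_gegenbauer \<tau> x k w))"
    unfolding ge2 by (simp add: algebra_simps del: solid_gegenbauer.simps)
  also have "\<dots> = (real k + 2) * (real (Suc (Suc k)) * solid_gegenbauer \<tau> x (Suc (Suc k)) w)"
    by (subst solid_gegenbauer.simps(3)) (simp del: solid_gegenbauer.simps)
  finally show ?case
    by (simp del: solid_gegenbauer.simps solid_gegenbauer_grad.simps)
qed simp_all

text \<open>The derivative in the direction of the pole \<open>x\<close> lowers the degree by one. This is the one relation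
  between consecutive degrees that harmonicity requires: applied to the recurrence, the Laplacian
  yields a term \<open>x \<bullet> solid_gegenbauer_grad\<close> from the factor \<open>x \<bullet> w\<close>.\<close>

lemma solid_gegenbauer_grad_pole:
  assumes "norm x = 1"
  shows "x \<bullet> solid_gegenbauer_grad \<tau> x (Suc k) w = (real k + 2 * \<tau>) * solid_gegenbauer \<tau> x k w"
proof (induction k rule: induct_nat_012)
  case (ge2 k)
  have x: "x \<bullet> x = 1" using assms by (simp add: dot_square_norm)
  have "x \<bullet> solid_gegenbauer_grad \<tau> x (Suc (Suc (Suc k))) w =
      (2 * (real k + 2 + \<tau>) * (solid_gegenbauer \<tau> x (Suc (Suc k)) w
           + (x \<bullet> w) * (x \<bullet> solid_gegenbauer_grad \<tau> x (Suc (Suc k)) w))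
       - (real k + 1 + 2 * \<tau>) * (2 * solid_gegenbauer \<tau> x (Suc k) w * (x \<bullet> w)
           + (w \<bullet> w) * (x \<bullet> solid_gegenbauer_grad \<tau> x (Suc k) w))) / (real k + 3)"
    by (subst solid_gegenbauer_grad.simps(3))
       (simp add: inner_diff_right inner_add_right x divide_inverse add_ac
          del: solid_gegenbauer_grad.simps solid_gegenbauer.simps)
  then have "(real k + 3) * (x \<bullet> solid_gegenbauer_grad \<tau> x (Suc (Suc (Suc k))) w) =
      2 * (real k + 2 + \<tau>) * (solid_gegenbauer \<tau> x (Suc (Suc k)) w
           + (x \<bullet> w) * ((real (Suc k) + 2 * \<tau>) * solid_gegenbauer \<tau> x (Suc k) w))
       - (real k + 1 + 2 * \<tau>) * (2 * solid_gegenbauer \<tau> x (Suc k) w * (x \<bullet> w)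
           + (w \<bullet> w) * ((real k + 2 * \<tau>) * solid_gegenbauer \<tau> x k w))"
    unfolding ge2 by (simp del: solid_gegenbauer_grad.simps solid_gegenbauer.simps)
  also have "\<dots> = 2 * (real k + 2 + \<tau>) * solid_gegenbauer \<tau> x (Suc (Suc k)) w
     + (real k + 1 + 2 * \<tau>) * ((real k + 2) * solid_gegenbauer \<tau> x (Suc (Suc k)) w)"
    by simp (simp add: algebra_simps)
  also have "\<dots> = (real k + 3) * ((real k + 2 + 2 * \<tau>) * solid_gegenbauer \<tau> x (Suc (Suc k)) w)"
    by (simp add: algebra_simps del: solid_gegenbauer.simps)
  finally show ?case
    by (simp add: add_ac del: solid_gegenbauer.simps solid_gegenbauer_grad.simps)
qed (use assms in \<open>simp_all add: inner_diff_right inner_add_right field_simps dot_square_norm\<close>)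

text \<open>The Laplacian of the recurrence reduces, by induction, to the cross terms of the two products.
  The first equals \<open>4 (k + 1 + \<tau>) (k + 2 \<tau>) P\<^sub>k\<close> by the previous lemma, the second
  \<open>(k + 2 \<tau>) (2 d + 4 k) P\<^sub>k\<close> by Euler's identity, and they cancel exactly when \<open>d = 2 \<tau> + 2\<close>.\<close>

lemma solid_gegenbauer_harmonic:
  fixes x w :: "'a::euclidean_space"
  assumes "norm x = 1" and \<tau>: "\<tau> = (real DIM('a) - 2) / 2"
  shows "(\<Sum>e\<in>Basis. solid_gegenbauer_deriv2 \<tau> x k e w) = 0"
proof (induction k rule: induct_nat_012)
  case (ge2 k)
  have sum: "(\<Sum>e\<in>A. (a * (2 * f e + b * g e) - c * (p * h e + 4 * i e + m * j e)) / r) =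
      (a * (2 * sum f A + b * sum g A) - c * (p * sum h A + 4 * sum i A + m * sum j A)) / r"
    for A :: "'a set" and a b c m r p and f g h i j :: "'a \<Rightarrow> real"
    by (simp add: sum.distrib sum_subtractf flip: sum_distrib_left sum_divide_distrib)
  have "(\<Sum>e\<in>Basis. solid_gegenbauer_deriv2 \<tau> x (Suc (Suc k)) e w) =
     (2 * (real k + 1 + \<tau>) * (2 * (\<Sum>e\<in>Basis. (x \<bullet> e) * (solid_gegenbauer_grad \<tau> x (Suc k) w \<bullet> e))
           + (x \<bullet> w) * (\<Sum>e\<in>Basis. solid_gegenbauer_deriv2 \<tau> x (Suc k) e w))
       - (real k + 2 * \<tau>) * (2 * solid_gegenbauer \<tau> x k w * (\<Sum>e\<in>(Basis::'a set). e \<bullet> e)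
           + 4 * (\<Sum>e\<in>Basis. (w \<bullet> e) * (solid_gegenbauer_grad \<tau> x k w \<bullet> e))
           + (w \<bullet> w) * (\<Sum>e\<in>Basis. solid_gegenbauer_deriv2 \<tau> x k e w))) / (real k + 2)"
    unfolding solid_gegenbauer_deriv2.simps(3) by (rule sum)
  also have "\<dots> = (4 * (real k + 1 + \<tau>) * (x \<bullet> solid_gegenbauer_grad \<tau> x (Suc k) w)
       - (real k + 2 * \<tau>) * (2 * solid_gegenbauer \<tau> x k w * real DIM('a)
           + 4 * (solid_gegenbauer_grad \<tau> x k w \<bullet> w))) / (real k + 2)"
    unfolding ge2 inner_commute[of "solid_gegenbauer_grad \<tau> x k w" w]
    by (simp add: inner_same_Basis flip: euclidean_inner)
  also have "\<dots> = 0"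
    unfolding solid_gegenbauer_grad_pole[OF assms(1)] solid_gegenbauer_euler
  proof -
    have "real DIM('a) = 2 * \<tau> + 2" using \<tau> by simp
    then show "(4 * (real k + 1 + \<tau>) * ((real k + 2 * \<tau>) * solid_gegenbauer \<tau> x k w)
       - (real k + 2 * \<tau>) * (2 * solid_gegenbauer \<tau> x k w * real DIM('a)
           + 4 * (real k * solid_gegenbauer \<tau> x k w))) / (real k + 2) = 0"
      by (simp only:) (simp add: algebra_simps)
  qed
  finally show ?case .
qed simp_all

lemma directional_derivative_mult:
  assumes "directional_derivative f e f'" "directional_derivative g e g'"
  shows "directional_derivative (\<lambda>w. f w * g w) e (\<lambda>w. f' w * g w + f w * g' w)"
  using assms unfolding directional_derivative_def by (auto intro!: derivative_eq_intros)

text \<open>Green's identity for harmonic polynomials: integrate \<open>\<partial>\<^sub>e (p * \<partial>\<^sub>e q)\<close> by parts and sum over an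
  orthonormal basis. The Laplacian of \<open>q\<close> drops out, and Euler's identity turns the radial derivative of
  \<open>q\<close> into \<open>l * q\<close>.\<close>

lemma integral_solid_gegenbauer_mult:
  fixes x y :: "'a::euclidean_space"
  assumes y: "norm y = 1" and \<tau>: "\<tau> = (real DIM('a) - 2) / 2"
  shows "(LINT w|sphere_measure. solid_gegenbauer_grad \<tau> x k w \<bullet> solid_gegenbauer_grad \<tau> y l w) =
    (real DIM('a) + real k + real l - 2) * real l *
    (LINT w|sphere_measure. solid_gegenbauer \<tau> x k w * solid_gegenbauer \<tau> y l w)"
proof -
  let ?p = "solid_gegenbauer \<tau> x k" and ?q = "solid_gegenbauer \<tau> y l"
  let ?gp = "solid_gegenbauer_grad \<tau> x k" and ?gq = "solid_gegenbauer_grad \<tau> y l"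
  let ?hq = "solid_gegenbauer_deriv2 \<tau> y l"
  note ints = integrable_sphere_measure[where 'a='a]
  have "(LINT w|sphere_measure. (?gp w \<bullet> e) * (?gq w \<bullet> e) + ?p w * ?hq e w) =
     (real DIM('a) + real (k + (l - 1)) - 1) * (LINT w|sphere_measure. ?p w * (?gq w \<bullet> e) * (w \<bullet> e))" for e
  proof (rule integral_sphere_directional_derivative)
    show "directional_derivative (\<lambda>w. ?p w * (?gq w \<bullet> e)) e (\<lambda>w. (?gp w \<bullet> e) * (?gq w \<bullet> e) + ?p w * ?hq e w)"
      by (intro directional_derivative_mult directional_derivative_solid_gegenbauer directional_derivative_solid_gegenbauer_grad)
    have "homogeneous (l - 1) (\<lambda>w. ?gq w \<bullet> e)"
      by (rule homogeneous_directional_derivative[OF _ directional_derivative_solid_gegenbauer homogeneous_solid_gegenbauer])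
         (intro continuous_intros)
    then show "homogeneous (k + (l - 1)) (\<lambda>w. ?p w * (?gq w \<bullet> e))"
      by (intro homogeneous_mult homogeneous_solid_gegenbauer)
  qed (intro continuous_intros)+
  then have "(\<Sum>e\<in>(Basis::'a set). LINT w|sphere_measure. (?gp w \<bullet> e) * (?gq w \<bullet> e) + ?p w * ?hq e w) =
     (real DIM('a) + real (k + (l - 1)) - 1) * (\<Sum>e\<in>(Basis::'a set). LINT w|sphere_measure. ?p w * (?gq w \<bullet> e) * (w \<bullet> e))"
    by (simp add: sum_distrib_left)
  also have "(\<Sum>e\<in>(Basis::'a set). LINT w|sphere_measure. ?p w * (?gq w \<bullet> e) * (w \<bullet> e)) =
     (LINT w|sphere_measure. (\<Sum>e\<in>(Basis::'a set). ?p w * (?gq w \<bullet> e) * (w \<bullet> e)))"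
    by (rule Bochner_Integration.integral_sum[symmetric]) (intro ints continuous_intros)
  also have "\<dots> = (LINT w|sphere_measure. real l * (?p w * ?q w))"
    by (simp add: mult.assoc solid_gegenbauer_euler mult.left_commute flip: sum_distrib_left euclidean_inner)
  also have "(\<Sum>e\<in>(Basis::'a set). LINT w|sphere_measure. (?gp w \<bullet> e) * (?gq w \<bullet> e) + ?p w * ?hq e w) =
     (LINT w|sphere_measure. (\<Sum>e\<in>(Basis::'a set). (?gp w \<bullet> e) * (?gq w \<bullet> e) + ?p w * ?hq e w))"
    by (rule Bochner_Integration.integral_sum[symmetric]) (intro ints continuous_intros)
  also have "\<dots> = (LINT w|sphere_measure. ?gp w \<bullet> ?gq w)"
    by (simp add: sum.distrib solid_gegenbauer_harmonic[OF y \<tau>] flip: sum_distrib_left euclidean_inner)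
  finally have "(LINT w|sphere_measure. ?gp w \<bullet> ?gq w) =
    (real DIM('a) + real (k + (l - 1)) - 1) * (real l * (LINT w|sphere_measure. ?p w * ?q w))"
    by simp
  then show ?thesis
    by (cases l) (simp_all add: algebra_simps)
qed

text \<open>The left-hand side of the previous identity is symmetric in the two polynomials, so
  \<open>(d + k + l - 2) * l\<close> and \<open>(d + k + l - 2) * k\<close> times their inner product agree.\<close>

lemma solid_gegenbauer_orthogonal:
  fixes x y :: "'a::euclidean_space"
  assumes xy: "norm x = 1" "norm y = 1" and d: "2 < DIM('a)" and \<tau>: "\<tau> = (real DIM('a) - 2) / 2"
    and kl: "k \<noteq> l"
  shows "(LINT w|sphere_measure. solid_gegenbauer \<tau> x k w * solid_gegenbauer \<tau> y l w) = 0" (is "?I = 0")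
proof -
  have "(real DIM('a) + real k + real l - 2) * real l * ?I = (real DIM('a) + real k + real l - 2) * real k * ?I"
    using integral_solid_gegenbauer_mult[OF xy(2) \<tau>, of x k l]
      integral_solid_gegenbauer_mult[OF xy(1) \<tau>, of y l k]
    by (simp add: inner_commute mult.commute add_ac)
  moreover have "real DIM('a) + real k + real l - 2 \<noteq> 0"
    using d by linarith
  ultimately show ?thesis
    using kl by simp
qed

section \<open>Sphere integrals of zonal functions\<close>

definition gegenbauer_weight_integral :: "real \<Rightarrow> (real \<Rightarrow> real) \<Rightarrow> real" where
  "gegenbauer_weight_integral \<beta> g = (LINT t:{-1..1}|lborel. g t * (1 - t\<^sup>2) powr \<beta>)"

lemma powr_weight_le_1:
  fixes \<beta> t :: real
  shows "0 \<le> \<beta> \<Longrightarrow> \<bar>t\<bar> \<le> 1 \<Longrightarrow> (1 - t\<^sup>2) powr \<beta> \<le> 1"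
  using powr_mono2[of \<beta> "1 - t\<^sup>2" 1] by (simp add: abs_square_le_1)

lemma set_integrable_gegenbauer_weight:
  assumes "0 \<le> \<beta>" "continuous_on UNIV g"
  shows "set_integrable lborel {-1..1} (\<lambda>t::real. g t * (1 - t\<^sup>2) powr \<beta>)"
proof -
  have [measurable]: "g \<in> borel_measurable borel"
    using assms(2) by (rule borel_measurable_continuous_onI)
  obtain M where M: "0 \<le> M" "\<And>t. norm t \<le> 1 \<Longrightarrow> \<bar>g t\<bar> \<le> M"
    using bounded_on_ball[OF assms(2)] by blast
  show ?thesis
    unfolding set_integrable_def
  proof (rule integrableI_bounded_set_indicator[where B=M])
    show "AE t in lborel. t \<in> {-1..1} \<longrightarrow> norm (g t * (1 - t\<^sup>2) powr \<beta>) \<le> M"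
    proof (intro AE_I2 impI)
      fix t :: real assume t: "t \<in> {-1..1}"
      have "\<bar>g t\<bar> * (1 - t\<^sup>2) powr \<beta> \<le> M * 1"
        using M t powr_weight_le_1[OF assms(1), of t] by (intro mult_mono) auto
      then show "norm (g t * (1 - t\<^sup>2) powr \<beta>) \<le> M" by (simp add: abs_mult)
    qed
  qed auto
qed

text \<open>The derivative of \<open>t ^ n * (1 - t\<^sup>2) powr (\<beta> + 1)\<close>, which vanishes at both end points, expands
  into the two weighted monomials.\<close>

lemma gegenbauer_weight_moment_rec:
  assumes \<beta>: "0 \<le> \<beta>"
  shows "real n * gegenbauer_weight_integral \<beta> (\<lambda>t. t ^ (n - 1)) =
    (real n + 2 * \<beta> + 2) * gegenbauer_weight_integral \<beta> (\<lambda>t. t ^ (n + 1))"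
proof -
  let ?w = "\<lambda>t::real. (1 - t\<^sup>2) powr \<beta>"
  define f' where "f' = (\<lambda>t. real n * (t ^ (n - 1) * ?w t) - (real n + 2 * \<beta> + 2) * (t ^ (n + 1) * ?w t))"
  have cont: "continuous_on {-1..1} (\<lambda>t::real. t ^ n * (1 - t\<^sup>2) powr (\<beta> + 1))"
    using \<beta> by (intro continuous_intros continuous_on_powr') (auto simp: abs_square_le_1 abs_le_iff)
  have deriv: "((\<lambda>t. t ^ n * (1 - t\<^sup>2) powr (\<beta> + 1)) has_vector_derivative f' t) (at t)"
    if t: "t \<in> {-1<..<1}" for t :: real
  proof -
    have "t\<^sup>2 < 1" using t by (simp add: abs_square_less_1 abs_less_iff)
    then have pos: "0 < 1 - t\<^sup>2" by simp
    have "((\<lambda>t. 1 - t\<^sup>2) has_real_derivative - 2 * t) (at t)"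
      by (auto intro!: derivative_eq_intros)
    from DERIV_mult[OF DERIV_pow[of n] DERIV_fun_powr[OF this pos, of "\<beta> + 1"]]
    have "((\<lambda>t. t ^ n * (1 - t\<^sup>2) powr (\<beta> + 1)) has_real_derivative
        real n * t ^ (n - 1) * (1 - t\<^sup>2) powr (\<beta> + 1) + t ^ n * ((\<beta> + 1) * (1 - t\<^sup>2) powr \<beta> * (- 2 * t))) (at t)"
      by (rule DERIV_cong) simp
    moreover have "(1 - t\<^sup>2) powr (\<beta> + 1) = (1 - t\<^sup>2) * ?w t"
      using pos by (simp add: powr_add)
    moreover have "real n * t ^ (n - 1) * ((1 - t\<^sup>2) * ?w t) + t ^ n * ((\<beta> + 1) * ?w t * (- 2 * t)) = f' t"
      by (cases n) (simp_all add: f'_def algebra_simps power2_eq_square)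
    ultimately show ?thesis
      by (simp add: has_real_derivative_iff_has_vector_derivative)
  qed
  have "(f' has_integral 0) {-1..1}"
    using fundamental_theorem_of_calculus_interior[OF _ cont deriv] by simp
  moreover have int: "set_integrable lborel {-1..1} (\<lambda>t. t ^ k * ?w t)" for k
    using \<beta> by (intro set_integrable_gegenbauer_weight continuous_intros)
  moreover have "set_integrable lborel {-1..1} f'"
    unfolding f'_def by (intro set_integral_diff(1) set_integrable_mult_right int)
  ultimately have "(LINT t:{-1..1}|lborel. f' t) = 0"
    using set_borel_integral_eq_integral(2) by (metis integral_unique)
  then show ?thesis
    unfolding f'_def gegenbauer_weight_integral_def
      set_integral_diff(2)[OF set_integrable_mult_right[OF int] set_integrable_mult_right[OF int]]
    by simp
qed

text \<open>Integration by parts on the sphere for \<open>(x \<bullet> w) ^ n\<close> in the direction \<open>x\<close> itself. For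
  \<open>2 \<beta> + 3 = d\<close> this is the same recurrence as for the weighted moments.\<close>

lemma sphere_moment_rec:
  fixes x :: "'a::euclidean_space"
  assumes x: "norm x = 1"
  shows "real n * (LINT w|sphere_measure. (x \<bullet> w) ^ (n - 1)) =
    (real DIM('a) + real n - 1) * (LINT w|sphere_measure. (x \<bullet> w) ^ (n + 1))"
proof -
  have xx: "x \<bullet> x = 1" using x by (simp add: dot_square_norm)
  have "(LINT w|sphere_measure. real n * (x \<bullet> w) ^ (n - 1)) =
     (real DIM('a) + real n - 1) * (LINT w|sphere_measure. (x \<bullet> w) ^ n * (w \<bullet> x))"
  proof (rule integral_sphere_directional_derivative)
    show "directional_derivative (\<lambda>w. (x \<bullet> w) ^ n) x (\<lambda>w. real n * (x \<bullet> w) ^ (n - 1))"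
      unfolding directional_derivative_def inner_add_right inner_scaleR_right xx
      by (auto intro!: derivative_eq_intros)
    show "homogeneous n (\<lambda>w. (x \<bullet> w) ^ n)"
      by (simp add: homogeneous_def power_mult_distrib)
  qed (intro continuous_intros)+
  then show ?thesis
    by (simp add: inner_commute mult.commute)
qed

lemma measure_sphere_pos: "0 < measure sphere_measure (sphere (0::'a::euclidean_space) 1)"
proof -
  have "measure sphere_measure (sphere (0::'a) 1) = (LINT w|sphere_measure. (\<lambda>_::'a. 1::real) w)"
    by simp
  also have "\<dots> = real DIM('a) * measure lborel (ball (0::'a) 1)"
    by (subst integral_sphere_measure) (auto simp: set_lebesgue_integral_def)
  also have "\<dots> > 0"
    by (simp add: content_ball_pos)
  finally show ?thesis .
qed

lemma gegenbauer_weight_integral_pos: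
  assumes "0 \<le> \<beta>"
  shows "0 < gegenbauer_weight_integral \<beta> (\<lambda>_. 1)"
proof -
  have int: "integrable lborel (\<lambda>t. indicator {-1..1} t * (1 - t\<^sup>2) powr \<beta> :: real)"
    using set_integrable_gegenbauer_weight[OF assms, of "\<lambda>_. 1"] by (simp add: set_integrable_def)
  have "0 \<le> (LINT t|lborel. indicator {-1..1} t * (1 - t\<^sup>2) powr \<beta> :: real)"
    by (intro Bochner_Integration.integral_nonneg) auto
  moreover have "(LINT t|lborel. indicator {-1..1} t * (1 - t\<^sup>2) powr \<beta> :: real) \<noteq> 0"
  proof
    assume "(LINT t|lborel. indicator {-1..1} t * (1 - t\<^sup>2) powr \<beta> :: real) = 0"
    then have "AE t in lborel. indicator {-1..1} t * (1 - t\<^sup>2) powr \<beta> = (0::real)"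
      by (subst (asm) integral_nonneg_eq_0_iff_AE[OF int]) auto
    then have "AE t in lborel. t \<notin> {-1<..<1::real}"
    proof eventually_elim
      case (elim t)
      show ?case
      proof
        assume "t \<in> {-1<..<1}"
        moreover from this have "t\<^sup>2 < 1" by (simp add: abs_square_less_1 abs_less_iff)
        ultimately show False using elim by simp
      qed
    qed
    then have "emeasure lborel {-1<..<1::real} = 0"
      by (subst (asm) AE_iff_measurable[of "{-1<..<1::real}"]) auto
    then show False by simp
  qed
  ultimately show ?thesis
    unfolding gegenbauer_weight_integral_def set_lebesgue_integral_def real_scaleR_def mult_1 by linarith
qed

text \<open>Both sides are linear in \<open>g\<close>, agree for \<open>g = 1\<close>, and their moments satisfy the same two-step
  recurrence; the odd moments vanish because the recurrence at \<open>n = 0\<close> gives the first one as \<open>0\<close>.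
  So they agree on polynomials, and on continuous functions by the Weierstrass theorem.\<close>

lemma integral_sphere_zonal:
  fixes x :: "'a::euclidean_space" and g :: "real \<Rightarrow> real"
  assumes x: "norm x = 1" and d: "3 \<le> DIM('a)" and \<beta>: "\<beta> = (real DIM('a) - 3) / 2"
    and g: "continuous_on UNIV g"
  shows "(LINT w|sphere_measure. g (x \<bullet> w)) =
    measure sphere_measure (sphere (0::'a) 1) / gegenbauer_weight_integral \<beta> (\<lambda>_. 1)
      * gegenbauer_weight_integral \<beta> g"
proof -
  define M where "M = measure sphere_measure (sphere (0::'a) 1)"
  define W where "W = gegenbauer_weight_integral \<beta> (\<lambda>_. 1)"
  define S where "S = (\<lambda>h. LINT w|sphere_measure. (h (x \<bullet> w) :: real))"
  define V where "V = gegenbauer_weight_integral \<beta>"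
  have \<beta>0: "0 \<le> \<beta>" using d by (simp add: \<beta>)
  have M: "0 < M" and W: "0 < W"
    using measure_sphere_pos gegenbauer_weight_integral_pos[OF \<beta>0] by (auto simp: M_def W_def)
  have intS: "integrable sphere_measure (\<lambda>w. h (x \<bullet> w))" if "continuous_on UNIV h" for h :: "real \<Rightarrow> real"
    by (intro integrable_sphere_measure continuous_on_compose2[OF that]) (auto intro: continuous_intros)
  have "S (\<lambda>t. t ^ n) * W = V (\<lambda>t. t ^ n) * M" for n
  proof (induction n rule: induct_nat_012)
    case 0
    then show ?case by (simp add: S_def V_def W_def M_def)
  next
    case 1
    show ?case
      using sphere_moment_rec[OF x, of 0] gegenbauer_weight_moment_rec[OF \<beta>0, of 0] d \<beta>0
      by (auto simp: S_def V_def)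
  next
    case (ge2 n)
    have dim: "real (Suc n) + 2 * \<beta> + 2 = real DIM('a) + real n"
      by (simp add: \<beta> field_simps)
    have s: "real (Suc n) * S (\<lambda>t. t ^ n) = (real DIM('a) + real n) * S (\<lambda>t. t ^ Suc (Suc n))"
      using sphere_moment_rec[OF x, of "Suc n"] by (simp add: S_def)
    have v: "real (Suc n) * V (\<lambda>t. t ^ n) = (real DIM('a) + real n) * V (\<lambda>t. t ^ Suc (Suc n))"
      using gegenbauer_weight_moment_rec[OF \<beta>0, of "Suc n"] unfolding dim by (simp add: V_def)
    have "(real DIM('a) + real n) * (S (\<lambda>t. t ^ Suc (Suc n)) * W) = real (Suc n) * (S (\<lambda>t. t ^ n) * W)"
      unfolding mult.assoc[symmetric] s by simp
    also have "\<dots> = (real DIM('a) + real n) * (V (\<lambda>t. t ^ Suc (Suc n)) * M)"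
      unfolding ge2(1) mult.assoc[symmetric] v by simp
    finally show ?case using d by simp
  qed
  note moments = this
  have poly: "S p * W = V p * M" if p: "p = (\<lambda>t. \<Sum>i\<le>n. a i * t ^ i)" for p and n :: nat and a
  proof -
    have "S p = (\<Sum>i\<le>n. a i * S (\<lambda>t. t ^ i))"
      unfolding S_def p
      by (subst Bochner_Integration.integral_sum)
         (intro integrable_mult_right intS continuous_intros, simp)
    moreover have "V p = (\<Sum>i\<le>n. a i * V (\<lambda>t. t ^ i))"
    proof -
      have ints: "set_integrable lborel {-1..1} (\<lambda>t. a i * (t ^ i * (1 - t\<^sup>2) powr \<beta>))" for i
        by (intro set_integrable_mult_right set_integrable_gegenbauer_weight \<beta>0 continuous_intros)
      have "V p = (LINT t:{-1..1}|lborel. (\<Sum>i\<le>n. a i * (t ^ i * (1 - t\<^sup>2) powr \<beta>)))"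
        by (simp add: V_def gegenbauer_weight_integral_def p sum_distrib_right mult.assoc)
      also have "\<dots> = (\<Sum>i\<le>n. LINT t:{-1..1}|lborel. a i * (t ^ i * (1 - t\<^sup>2) powr \<beta>))"
        unfolding set_lebesgue_integral_def scaleR_sum_right
        by (intro Bochner_Integration.integral_sum ints[unfolded set_integrable_def])
      finally show ?thesis by (simp add: V_def gegenbauer_weight_integral_def)
    qed
    ultimately show ?thesis
      by (simp add: sum_distrib_right mult.assoc moments)
  qed
  have close: "\<bar>S g * W - V g * M\<bar> \<le> 2 * (M * W) * e" if e: "0 < e" for e
  proof -
    have "continuous_on {-1..1} g" using g by (rule continuous_on_subset) auto
    then obtain p where p: "real_polynomial_function p" "\<And>t. t \<in> {-1..1} \<Longrightarrow> \<bar>g t - p t\<bar> < e"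
      using Stone_Weierstrass_real_polynomial_function[of "{-1..1}" g e] e by auto
    obtain a n where pa: "p = (\<lambda>t. \<Sum>i\<le>n. a i * t ^ i)"
      using real_polynomial_function_imp_sum[OF p(1)] by blast
    have pc: "continuous_on UNIV p" unfolding pa by (intro continuous_intros)
    have gp: "continuous_on UNIV (\<lambda>t. g t - p t)" by (intro continuous_intros g pc)
    have "\<bar>S g - S p\<bar> \<le> M * e"
    proof -
      have "S g - S p = (LINT w|sphere_measure. g (x \<bullet> w) - p (x \<bullet> w))"
        by (simp add: S_def intS g pc)
      also have "\<bar>\<dots>\<bar> \<le> (LINT w|sphere_measure. \<bar>g (x \<bullet> w) - p (x \<bullet> w)\<bar>)"
        by (rule integral_abs_bound)
      also have "\<dots> \<le> (LINT w|sphere_measure. (\<lambda>_::'a. e) w)"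
      proof (rule integral_mono)
        show "integrable sphere_measure (\<lambda>w. \<bar>g (x \<bullet> w) - p (x \<bullet> w)\<bar>)"
          using intS[OF gp] by simp
        show "integrable sphere_measure (\<lambda>_::'a. e)"
          by (rule integrable_sphere_measure) (rule continuous_on_const)
        fix w :: 'a assume "w \<in> space sphere_measure"
        then have "\<bar>x \<bullet> w\<bar> \<le> 1"
          using Cauchy_Schwarz_ineq2[of x w] x by simp
        then show "\<bar>g (x \<bullet> w) - p (x \<bullet> w)\<bar> \<le> e"
          using p(2)[of "x \<bullet> w"] by (auto simp: abs_le_iff)
      qed
      also have "\<dots> = M * e" by (simp add: M_def)
      finally show ?thesis .
    qed
    moreover have "\<bar>V g - V p\<bar> \<le> W * e"
    proof -
      note intV = set_integrable_gegenbauer_weight[OF \<beta>0]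
      have "V g - V p = (LINT t:{-1..1}|lborel. (g t - p t) * (1 - t\<^sup>2) powr \<beta>)"
        using intV[OF g] intV[OF pc]
        by (simp add: V_def gegenbauer_weight_integral_def left_diff_distrib)
      also have "\<bar>\<dots>\<bar> \<le> (LINT t:{-1..1}|lborel. \<bar>(g t - p t) * (1 - t\<^sup>2) powr \<beta>\<bar>)"
        using set_integral_norm_bound[OF intV[OF gp]] by simp
      also have "\<dots> \<le> (LINT t:{-1..1}|lborel. e * (1 - t\<^sup>2) powr \<beta>)"
      proof (rule set_integral_mono)
        show "set_integrable lborel {-1..1} (\<lambda>t. \<bar>(g t - p t) * (1 - t\<^sup>2) powr \<beta>\<bar>)"
          by (intro set_integrable_abs intV gp)
        show "set_integrable lborel {-1..1} (\<lambda>t::real. e * (1 - t\<^sup>2) powr \<beta>)"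
          by (intro intV continuous_intros)
        fix t :: real assume "t \<in> {-1..1}"
        then show "\<bar>(g t - p t) * (1 - t\<^sup>2) powr \<beta>\<bar> \<le> e * (1 - t\<^sup>2) powr \<beta>"
          using p(2)[of t] by (simp add: abs_mult mult_right_mono)
      qed
      also have "\<dots> = W * e" by (simp add: W_def gegenbauer_weight_integral_def)
      finally show ?thesis .
    qed
    ultimately have "\<bar>S g - S p\<bar> * W \<le> M * e * W" "\<bar>V g - V p\<bar> * M \<le> W * e * M"
      using M W by (auto intro!: mult_right_mono)
    then have "\<bar>(S g - S p) * W\<bar> \<le> M * W * e" "\<bar>(V g - V p) * M\<bar> \<le> M * W * e"
      using M W by (simp_all add: abs_mult mult_ac)
    moreover have "S g * W - V g * M = (S g - S p) * W - (V g - V p) * M"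
      using poly[OF pa] by (simp add: algebra_simps)
    ultimately show ?thesis by linarith
  qed
  have "\<bar>S g * W - V g * M\<bar> \<le> 0"
  proof (rule field_le_epsilon)
    fix e :: real assume "0 < e"
    then show "\<bar>S g * W - V g * M\<bar> \<le> 0 + e"
      using close[of "e / (2 * (M * W))"] M W by simp
  qed
  then have "S g * W = V g * M" by simp
  then have "S g = V g * M / W"
    using W by (metis less_irrefl nonzero_mult_div_cancel_right)
  then have "S g = M / W * V g" by simp
  then show ?thesis
    by (simp add: S_def V_def M_def W_def)
qed

section \<open>Decay of normalised Gegenbauer polynomials\<close>

lemma gegenbauer_one_Suc:
  "(real k + 1) * gegenbauer \<tau> (Suc k) 1 = (real k + 2 * \<tau>) * gegenbauer \<tau> k 1"
proof (induction k)
  case (Suc k)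
  have "(real k + 2) * gegenbauer \<tau> (Suc (Suc k)) 1 =
      2 * (real k + 1 + \<tau>) * gegenbauer \<tau> (Suc k) 1 - (real k + 2 * \<tau>) * gegenbauer \<tau> k 1"
    by simp
  also have "\<dots> = (real k + 1 + 2 * \<tau>) * gegenbauer \<tau> (Suc k) 1"
    unfolding Suc[symmetric] by (simp add: algebra_simps del: gegenbauer.simps)
  finally show ?case by (simp add: add_ac del: gegenbauer.simps)
qed simp

lemma gegenbauer_one_pos: "0 < \<tau> \<Longrightarrow> 0 < gegenbauer \<tau> k 1"
proof (induction k)
  case (Suc k)
  then have "0 < (real k + 1) * gegenbauer \<tau> (Suc k) 1"
    unfolding gegenbauer_one_Suc by (intro mult_pos_pos) auto
  then show ?case by (simp add: zero_less_mult_iff del: gegenbauer.simps)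
qed simp

lemma gegenbauer_minus: "gegenbauer \<tau> k (- t) = (-1) ^ k * gegenbauer \<tau> k t"
proof (induction k rule: induct_nat_012)
  case (ge2 k)
  then show ?case by (simp add: algebra_simps diff_divide_distrib)
qed simp_all

definition normalized_gegenbauer :: "real \<Rightarrow> real \<Rightarrow> nat \<Rightarrow> real" where
  "normalized_gegenbauer \<tau> t k = gegenbauer \<tau> k t / gegenbauer \<tau> k 1"

text \<open>Dividing by the values at \<open>1\<close>, whose consecutive ratios are \<open>gegenbauer_one_Suc\<close>, gives a recurrence
  whose coefficients tend to those of \<open>c\<^sub>k\<^sub>+\<^sub>2 = 2 t c\<^sub>k\<^sub>+\<^sub>1 - c\<^sub>k\<close>.\<close>

lemma normalized_gegenbauer_rec:
  assumes "0 < \<tau>"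
  shows "(real k + 1 + 2 * \<tau>) * normalized_gegenbauer \<tau> t (Suc (Suc k)) =
    2 * (real k + 1 + \<tau>) * t * normalized_gegenbauer \<tau> t (Suc k) - (real k + 1) * normalized_gegenbauer \<tau> t k"
proof -
  define c where "c = normalized_gegenbauer \<tau> t"
  define N where "N = (\<lambda>k. gegenbauer \<tau> k 1)"
  have N: "N k > 0" for k using gegenbauer_one_pos[OF assms] by (simp add: N_def)
  have C: "gegenbauer \<tau> k t = N k * c k" for k
    using N[of k] by (simp add: c_def N_def normalized_gegenbauer_def)
  have N2: "(real k + 2) * N (Suc (Suc k)) = (real k + 1 + 2 * \<tau>) * N (Suc k)"
    using gegenbauer_one_Suc[of "Suc k" \<tau>] by (simp add: N_def add_ac del: gegenbauer.simps)
  have N1: "(real k + 1) * N (Suc k) = (real k + 2 * \<tau>) * N k"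
    using gegenbauer_one_Suc[of k \<tau>] by (simp add: N_def del: gegenbauer.simps)
  have "(real k + 2) * gegenbauer \<tau> (Suc (Suc k)) t =
      2 * t * (real k + 1 + \<tau>) * gegenbauer \<tau> (Suc k) t - (real k + 2 * \<tau>) * gegenbauer \<tau> k t"
    by simp
  then have "((real k + 2) * N (Suc (Suc k))) * c (Suc (Suc k)) =
      2 * t * (real k + 1 + \<tau>) * (N (Suc k) * c (Suc k)) - ((real k + 2 * \<tau>) * N k) * c k"
    unfolding C by (simp add: mult.assoc)
  then have "N (Suc k) * ((real k + 1 + 2 * \<tau>) * c (Suc (Suc k))) =
      N (Suc k) * (2 * (real k + 1 + \<tau>) * t * c (Suc k) - (real k + 1) * c k)"
    unfolding N2 N1[symmetric] by (simp add: algebra_simps)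
  then show ?thesis
    using N[of "Suc k"] by (simp add: c_def)
qed

text \<open>An energy argument. The limiting recurrence \<open>c\<^sub>k\<^sub>+\<^sub>2 = 2 t c\<^sub>k\<^sub>+\<^sub>1 - c\<^sub>k\<close> preserves the quadratic form
  \<open>Q\<close> below, which is positive definite because \<open>|t| < 1\<close>. For the true recurrence the form \<open>A\<close>, which is
  \<open>k * Q\<close> up to terms of order \<open>Q\<close>, satisfies the exact relation \<open>step\<close>; together with \<open>2 \<tau> \<ge> 1\<close> it
  shows that \<open>A\<close> stays bounded, so that \<open>Q\<close> and with it \<open>(c k)\<^sup>2\<close> is \<open>O(1/k)\<close>.\<close>

lemma normalized_gegenbauer_tendsto_0:
  assumes \<tau>: "1 / 2 \<le> \<tau>" and t: "\<bar>t\<bar> < 1"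
  shows "normalized_gegenbauer \<tau> t \<longlonglongrightarrow> 0"
proof -
  define c where "c = normalized_gegenbauer \<tau> t"
  define Q where "Q = (\<lambda>k. (c k)\<^sup>2 - 2 * t * c k * c (Suc k) + (c (Suc k))\<^sup>2)"
  define A where "A = (\<lambda>k. real k * (c k)\<^sup>2 - 2 * (real k + \<tau>) * t * c k * c (Suc k)
      + (real k + 2 * \<tau>) * (c (Suc k))\<^sup>2)"
  \<comment> \<open>The constant in \<open>A k \<ge> (k - B) * Q k\<close>: it bounds the cross term \<open>2 \<tau> t c\<^sub>k c\<^sub>k\<^sub>+\<^sub>1\<close> of
    \<open>A k - k * Q k\<close> in terms of \<open>Q k\<close>.\<close>
  define B where "B = \<tau> * \<bar>t\<bar> / (1 - \<bar>t\<bar>)"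
  have B: "0 \<le> B" using \<tau> t by (simp add: B_def)
  have xz: "2 * \<bar>t * c k * c (Suc k)\<bar> \<le> \<bar>t\<bar> * ((c k)\<^sup>2 + (c (Suc k))\<^sup>2)" for k
  proof -
    have "2 * (\<bar>c k\<bar> * \<bar>c (Suc k)\<bar>) \<le> (c k)\<^sup>2 + (c (Suc k))\<^sup>2"
      using sum_squares_bound[of "\<bar>c k\<bar>" "\<bar>c (Suc k)\<bar>"] by simp
    from mult_left_mono[OF this, of "\<bar>t\<bar>"] show ?thesis
      by (simp add: abs_mult mult_ac)
  qed
  have Q: "(1 - \<bar>t\<bar>) * ((c k)\<^sup>2 + (c (Suc k))\<^sup>2) \<le> Q k" for k
    using xz[of k] by (simp add: Q_def algebra_simps)
  have Q0: "0 \<le> Q k" for k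
    using t by (intro order_trans[OF _ Q]) auto
  have AQ: "(real k - B) * Q k \<le> A k" for k
  proof -
    have "2 * \<tau> * t * c k * c (Suc k) \<le> \<tau> * (2 * \<bar>t * c k * c (Suc k)\<bar>)"
      using \<tau> by (simp add: mult.assoc)
    also have "\<dots> \<le> \<tau> * (\<bar>t\<bar> * ((c k)\<^sup>2 + (c (Suc k))\<^sup>2))"
      using \<tau> xz by (intro mult_left_mono) auto
    also have "\<dots> = B * ((1 - \<bar>t\<bar>) * ((c k)\<^sup>2 + (c (Suc k))\<^sup>2))"
      using t by (simp add: B_def)
    also have "\<dots> \<le> B * Q k"
      using B Q by (intro mult_left_mono) auto
    finally have "2 * \<tau> * t * c k * c (Suc k) \<le> B * Q k" .
    moreover have "A k = real k * Q k - 2 * \<tau> * t * c k * c (Suc k) + 2 * \<tau> * (c (Suc k))\<^sup>2"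
      by (simp add: A_def Q_def algebra_simps)
    moreover have "0 \<le> 2 * \<tau> * (c (Suc k))\<^sup>2" using \<tau> by simp
    ultimately show ?thesis by (simp add: left_diff_distrib)
  qed
  have step: "(real k + 1 + 2 * \<tau>) * A (Suc k) = (real k + 1) * (A k + Q k)" for k
  proof -
    have eq: "(real k + 1 + 2 * \<tau>) * c (Suc (Suc k)) = 2 * (real k + 1 + \<tau>) * t * c (Suc k) - (real k + 1) * c k"
      using normalized_gegenbauer_rec[of \<tau> k t] \<tau> by (simp add: c_def)
    have alg: "m * (n * z\<^sup>2 - 2 * p * t * z * z' + m * z'\<^sup>2) = n * (m * z\<^sup>2 - 2 * p * t * x * z + n * x\<^sup>2)"
      if "m * z' = 2 * p * t * z - n * x" for m n p x z z' :: real
      using that by algebra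
    have "A (Suc k) = (real k + 1) * (c (Suc k))\<^sup>2 - 2 * (real k + 1 + \<tau>) * t * c (Suc k) * c (Suc (Suc k))
        + (real k + 1 + 2 * \<tau>) * (c (Suc (Suc k)))\<^sup>2"
      by (simp add: A_def add_ac)
    moreover have "A k + Q k = (real k + 1 + 2 * \<tau>) * (c (Suc k))\<^sup>2 - 2 * (real k + 1 + \<tau>) * t * c k * c (Suc k)
        + (real k + 1) * (c k)\<^sup>2"
      by (simp add: A_def Q_def algebra_simps)
    ultimately show ?thesis using alg[OF eq] by simp
  qed
  obtain K :: nat where K: "B < real K" using reals_Archimedean2 by blast
  \<comment> \<open>From \<open>step\<close> and \<open>Q k \<le> A k / (k - B)\<close> one gets
    \<open>A\<^sub>k\<^sub>+\<^sub>1 / A\<^sub>k \<le> (k + 1) / (k + 2) * (k + 1 - B) / (k - B)\<close>, which telescopes.\<close>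
  define D where "D = (\<lambda>k. A k * (real k + 1) / (real k - B))"
  have D: "D (Suc k) \<le> D k" if k: "K \<le> k" for k
  proof -
    have kB: "0 < real k - B" using k K by simp
    have "0 \<le> (real k - B) * Q k" using kB Q0 by simp
    then have A0: "0 \<le> A k" using AQ[of k] by linarith
    have "0 \<le> A k + Q k" using A0 Q0[of k] by simp
    then have "0 \<le> (real k + 1 + 2 * \<tau>) * A (Suc k)"
      unfolding step by (intro mult_nonneg_nonneg) auto
    moreover have "0 < real k + 1 + 2 * \<tau>" using \<tau> by simp
    ultimately have A1: "0 \<le> A (Suc k)" by (simp only: zero_le_mult_iff) linarith
    have "(real k + 2) * A (Suc k) \<le> (real k + 1 + 2 * \<tau>) * A (Suc k)"
      using \<tau> A1 by (intro mult_right_mono) auto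
    also have "\<dots> = (real k + 1) * (A k + Q k)" by (rule step)
    also have "\<dots> \<le> (real k + 1) * (A k + A k / (real k - B))"
      using AQ[of k] kB by (intro mult_left_mono add_left_mono) (auto simp: field_simps)
    also have "\<dots> = D k * (real (Suc k) - B)"
      using kB by (simp add: D_def divide_simps) (simp add: algebra_simps)
    finally show ?thesis
      using kB by (simp add: D_def divide_le_eq mult_ac add_ac)
  qed
  have DK: "D k \<le> D K" if "K \<le> k" for k
    using that by (induction k rule: dec_induct) (auto intro: order_trans[OF D])
  have bound: "(c k)\<^sup>2 \<le> D K / (1 - \<bar>t\<bar>) / (real k + 1)" if k: "K \<le> k" for k
  proof -
    have kB: "0 < real k - B" using k K by simp
    have "(1 - \<bar>t\<bar>) * (c k)\<^sup>2 \<le> (1 - \<bar>t\<bar>) * ((c k)\<^sup>2 + (c (Suc k))\<^sup>2)"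
      using t by (intro mult_left_mono) auto
    also have "\<dots> \<le> Q k" by (rule Q)
    also have "\<dots> \<le> A k / (real k - B)"
      using AQ[of k] kB by (simp add: pos_le_divide_eq mult.commute)
    also have "\<dots> = D k / (real k + 1)"
      by (simp add: D_def)
    also have "\<dots> \<le> D K / (real k + 1)"
      using DK[OF k] by (intro divide_right_mono) auto
    finally have "(c k)\<^sup>2 * (1 - \<bar>t\<bar>) \<le> D K / (real k + 1)"
      by (simp only: mult.commute)
    then have "(c k)\<^sup>2 \<le> D K / (real k + 1) / (1 - \<bar>t\<bar>)"
      using t by (simp only: pos_le_divide_eq diff_gt_0_iff_gt)
    also have "\<dots> = D K / (1 - \<bar>t\<bar>) / (real k + 1)" by simp
    finally show ?thesis .
  qed
  have "(\<lambda>k. (c k)\<^sup>2) \<longlonglongrightarrow> 0"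
  proof (rule tendsto_sandwich[where f="\<lambda>_. 0" and h="\<lambda>k. D K / (1 - \<bar>t\<bar>) / (real k + 1)"])
    show "\<forall>\<^sub>F k in sequentially. (c k)\<^sup>2 \<le> D K / (1 - \<bar>t\<bar>) / (real k + 1)"
      using bound by (auto simp: eventually_sequentially)
    have "(\<lambda>k. D K / (1 - \<bar>t\<bar>) * (1 / (real k + 1))) \<longlonglongrightarrow> D K / (1 - \<bar>t\<bar>) * 0"
      using LIMSEQ_inverse_real_of_nat by (intro tendsto_intros) (simp add: inverse_eq_divide add.commute)
    then show "(\<lambda>k. D K / (1 - \<bar>t\<bar>) / (real k + 1)) \<longlonglongrightarrow> 0" by simp
  qed auto
  then show ?thesis
    by (simp add: c_def tendsto_null_power)
qed

section \<open>Strict positive definiteness\<close>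

text \<open>By homogeneity the square also integrates to \<open>0\<close> over the unit ball. There \<open>h \<noteq> 0\<close> is an open set
  of measure \<open>0\<close>, hence empty, and a point of the sphere is twice a point of the ball.\<close>

lemma homogeneous_eq_0_on_sphere:
  fixes h :: "'a::euclidean_space \<Rightarrow> real"
  assumes h: "continuous_on UNIV h" "homogeneous m h"
    and zero: "(LINT w|sphere_measure. (h w)\<^sup>2) = 0" and w: "norm w = 1"
  shows "h w = 0"
proof -
  have hh: "continuous_on UNIV (\<lambda>w. h w * h w)" "homogeneous (m + m) (\<lambda>w. h w * h w)"
    using h by (auto intro: continuous_intros homogeneous_mult)
  have [measurable]: "h \<in> borel_measurable borel"
    using h(1) by (rule borel_measurable_continuous_onI)
  obtain M where M: "\<And>x. norm x \<le> 1 \<Longrightarrow> \<bar>h x * h x\<bar> \<le> M"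
    using bounded_on_ball[OF hh(1)] by blast
  have int: "integrable lborel (\<lambda>x. indicator (ball 0 1) x *\<^sub>R (h x * h x))"
    using set_integrable_bounded_on_ball[of "\<lambda>x. h x * h x" M "ball 0 1"] M
    by (simp add: set_integrable_def)
  have "(real DIM('a) + real (m + m)) * (LINT x:ball 0 1|lborel. h x * h x) = 0"
    using integral_sphere_measure_homogeneous[OF hh] zero by (simp add: power2_eq_square)
  moreover have "0 < real DIM('a) + real (m + m)"
    using DIM_positive[where 'a='a] by linarith
  ultimately have "(LINT x|lborel. indicator (ball 0 1) x *\<^sub>R (h x * h x)) = 0"
    by (simp add: set_lebesgue_integral_def)
  then have ae: "AE x in lborel. indicator (ball 0 1) x *\<^sub>R (h x * h x) = 0"
    by (subst (asm) integral_nonneg_eq_0_iff_AE[OF int]) auto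
  define U where "U = {x \<in> ball 0 1. h x \<noteq> 0}"
  have "open (ball 0 1 \<inter> h -` (- {0}))"
    using h(1) by (intro open_Int open_ball) (auto intro!: open_vimage)
  moreover have "U = ball 0 1 \<inter> h -` (- {0})" by (auto simp: U_def)
  ultimately have U: "open U" by simp
  have "AE x in lborel. x \<notin> U"
    using ae by eventually_elim (auto simp: U_def)
  then have "emeasure lborel U = 0"
    using U by (subst (asm) AE_iff_measurable[of U]) auto
  then have "negligible U"
    using U by (auto simp: negligible_iff_null_sets null_sets_def intro!: null_sets_completionI)
  then have "U = {}"
    using U open_not_negligible by blast
  then have "h ((1 / 2) *\<^sub>R w) = 0"
    using w by (auto simp: U_def)
  then show ?thesis
    using h(2) by (simp add: homogeneous_def)
qed

text \<open>Let \<open>R N\<close> be the combination with \<open>g\<close> replaced by the \<open>N\<close>-th partial sum of its expansion, and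
  \<open>E N\<close> the one with \<open>g\<close> replaced by the remainder. By orthogonality \<open>(a k)\<^sup>2 * \<integral> (P k)\<^sup>2\<close> is at most
  \<open>\<integral> (R N)\<^sup>2\<close> for \<open>N > k\<close>. Since the combination with \<open>g\<close> itself has norm \<open>0\<close>, this is at most
  \<open>2 * \<integral> (E N)\<^sup>2\<close>, which the zonal formula bounds by the weighted \<open>L\<^sup>2\<close> error of the expansion.\<close>

lemma zonal_combination_components_vanish:
  fixes x :: "'m::finite \<Rightarrow> 'a::euclidean_space" and g :: "real \<Rightarrow> real"
  assumes d: "3 \<le> DIM('a)" and \<tau>: "\<tau> = (real DIM('a) - 2) / 2"
    and g: "continuous_on UNIV g"
    and expansion: "(\<lambda>N. gegenbauer_weight_integral (\<tau> - 1 / 2)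
       (\<lambda>t. (g t - (\<Sum>k<N. a k * gegenbauer \<tau> k t))\<^sup>2)) \<longlonglongrightarrow> 0"
    and x: "\<And>i. norm (x i) = 1"
    and zero: "(LINT w|sphere_measure. (\<Sum>i\<in>UNIV. c i * g (x i \<bullet> w))\<^sup>2) = 0"
    and k: "a k \<noteq> 0" and y: "norm y = 1"
  shows "(\<Sum>i\<in>UNIV. c i * gegenbauer \<tau> k (x i \<bullet> y)) = 0"
proof -
  define P where "P = (\<lambda>k w. \<Sum>i\<in>UNIV. c i * solid_gegenbauer \<tau> (x i) k w)"
  define R where "R = (\<lambda>N w. \<Sum>k<N. a k * P k w)"
  define T where "T = (\<lambda>N t. \<Sum>k<N. a k * gegenbauer \<tau> k t)"
  define F where "F = (\<lambda>w. \<Sum>i\<in>UNIV. c i * g (x i \<bullet> w))"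
  define E where "E = (\<lambda>N w. \<Sum>i\<in>UNIV. c i * (g (x i \<bullet> w) - T N (x i \<bullet> w)))"
  define \<beta> where "\<beta> = \<tau> - 1 / 2"
  define V where "V = (\<lambda>N. gegenbauer_weight_integral \<beta> (\<lambda>t. (g t - T N t)\<^sup>2))"
  define \<kappa> where "\<kappa> = measure sphere_measure (sphere (0::'a) 1) / gegenbauer_weight_integral \<beta> (\<lambda>_. 1)"
  have \<beta>: "\<beta> = (real DIM('a) - 3) / 2" by (simp add: \<beta>_def \<tau> field_simps)
  note ints = integrable_sphere_measure[where 'a='a]
  have contP: "continuous_on UNIV (P k)" for k
    unfolding P_def by (intro continuous_intros)
  have contR: "continuous_on UNIV (R N)" for N
    unfolding R_def by (intro continuous_intros contP)
  have contG: "continuous_on UNIV (gegenbauer \<tau> k)" for k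
  proof (induction k rule: induct_nat_012)
    case (ge2 n)
    then show ?case by (auto intro!: continuous_intros)
  qed (auto intro!: continuous_intros)
  have contT: "continuous_on UNIV (T N)" for N
    unfolding T_def by (intro continuous_intros contG)
  have compose: "continuous_on UNIV (\<lambda>w. h (x i \<bullet> w))" if "continuous_on UNIV h" for h :: "real \<Rightarrow> real" and i
    by (rule continuous_on_compose2[OF that]) (auto intro!: continuous_intros)
  have contF: "continuous_on UNIV F"
    unfolding F_def by (intro continuous_intros compose g)
  have contE: "continuous_on UNIV (E N)" for N
    unfolding E_def by (intro continuous_intros compose g contT)
  have orth: "(LINT w|sphere_measure. P k w * P l w) = 0" if "k \<noteq> l" for k l
  proof -
    have "(LINT w|sphere_measure. P k w * P l w) =
        (LINT w|sphere_measure. (\<Sum>i\<in>UNIV. \<Sum>j\<in>UNIV. (c i * c j) *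
          (solid_gegenbauer \<tau> (x i) k w * solid_gegenbauer \<tau> (x j) l w)))"
      by (simp add: P_def sum_product mult_ac)
    also have "\<dots> = (\<Sum>i\<in>UNIV. LINT w|sphere_measure. (\<Sum>j\<in>UNIV. (c i * c j) *
          (solid_gegenbauer \<tau> (x i) k w * solid_gegenbauer \<tau> (x j) l w)))"
      by (intro Bochner_Integration.integral_sum ints continuous_intros)
    also have "\<dots> = (\<Sum>i\<in>UNIV. \<Sum>j\<in>UNIV. LINT w|sphere_measure. (c i * c j) *
          (solid_gegenbauer \<tau> (x i) k w * solid_gegenbauer \<tau> (x j) l w))"
      by (intro sum.cong refl Bochner_Integration.integral_sum ints continuous_intros)
    also have "\<dots> = 0"
      using d by (simp add: solid_gegenbauer_orthogonal[OF x x _ \<tau> that])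
    finally show ?thesis .
  qed
  have pyth: "(LINT w|sphere_measure. (R N w)\<^sup>2) = (\<Sum>k<N. (a k)\<^sup>2 * (LINT w|sphere_measure. (P k w)\<^sup>2))" for N
  proof (induction N)
    case (Suc N)
    have cross: "(LINT w|sphere_measure. R N w * P N w) = 0"
    proof -
      have "(LINT w|sphere_measure. R N w * P N w) = (LINT w|sphere_measure. (\<Sum>k<N. a k * (P k w * P N w)))"
        by (simp add: R_def sum_distrib_right mult.assoc)
      also have "\<dots> = (\<Sum>k<N. LINT w|sphere_measure. a k * (P k w * P N w))"
        by (intro Bochner_Integration.integral_sum ints continuous_intros contP)
      also have "\<dots> = 0" by (simp add: orth)
      finally show ?thesis .
    qed
    have "(LINT w|sphere_measure. (R (Suc N) w)\<^sup>2) =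
        (LINT w|sphere_measure. (R N w)\<^sup>2 + 2 * a N * (R N w * P N w) + (a N)\<^sup>2 * (P N w)\<^sup>2)"
      by (simp add: R_def power2_sum power_mult_distrib algebra_simps)
    also have "\<dots> = (LINT w|sphere_measure. (R N w)\<^sup>2) + 2 * a N * (LINT w|sphere_measure. R N w * P N w)
        + (a N)\<^sup>2 * (LINT w|sphere_measure. (P N w)\<^sup>2)"
      by (subst Bochner_Integration.integral_add, intro ints continuous_intros contP contR,
          intro ints continuous_intros contP contR,
          subst Bochner_Integration.integral_add, intro ints continuous_intros contP contR,
          intro ints continuous_intros contP contR) simp
    finally show ?case by (simp add: Suc.IH cross)
  qed (simp add: R_def)
  have RT: "R N w = F w - E N w" if "norm w = 1" for N w
  proof -
    have "R N w = (\<Sum>k<N. \<Sum>i\<in>UNIV. c i * (a k * gegenbauer \<tau> k (x i \<bullet> w)))"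
      using that by (simp add: R_def P_def sum_distrib_left solid_gegenbauer_sphere mult.left_commute)
    also have "\<dots> = (\<Sum>i\<in>UNIV. c i * T N (x i \<bullet> w))"
      unfolding T_def sum_distrib_left by (rule sum.swap)
    finally show ?thesis
      by (simp add: F_def E_def right_diff_distrib sum_subtractf)
  qed
  have E_bound: "(LINT w|sphere_measure. (E N w)\<^sup>2) \<le> (\<Sum>i\<in>UNIV. (c i)\<^sup>2) * (real CARD('m) * (\<kappa> * V N))" for N
  proof -
    have "(LINT w|sphere_measure. (E N w)\<^sup>2) \<le>
        (LINT w|sphere_measure. (\<Sum>i\<in>UNIV. (c i)\<^sup>2) * (\<Sum>i\<in>UNIV. (g (x i \<bullet> w) - T N (x i \<bullet> w))\<^sup>2))"
    proof (rule integral_mono)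
      show "(E N w)\<^sup>2 \<le> (\<Sum>i\<in>UNIV. (c i)\<^sup>2) * (\<Sum>i\<in>UNIV. (g (x i \<bullet> w) - T N (x i \<bullet> w))\<^sup>2)" for w
        unfolding E_def by (rule Cauchy_Schwarz_ineq_sum)
    qed (intro ints continuous_intros contE compose g contT)+
    also have "\<dots> = (\<Sum>i\<in>UNIV. (c i)\<^sup>2) * (LINT w|sphere_measure. (\<Sum>i\<in>UNIV. (g (x i \<bullet> w) - T N (x i \<bullet> w))\<^sup>2))"
      by (rule integral_mult_right_zero)
    also have "(LINT w|sphere_measure. (\<Sum>i\<in>UNIV. (g (x i \<bullet> w) - T N (x i \<bullet> w))\<^sup>2)) =
        (\<Sum>i\<in>UNIV. LINT w|sphere_measure. (g (x i \<bullet> w) - T N (x i \<bullet> w))\<^sup>2)"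
      by (intro Bochner_Integration.integral_sum ints continuous_intros compose g contT)
    also have "\<dots> = (\<Sum>i\<in>(UNIV::'m set). \<kappa> * V N)"
    proof (rule sum.cong[OF refl])
      fix i
      have "continuous_on UNIV (\<lambda>t. (g t - T N t)\<^sup>2)"
        by (intro continuous_intros g contT)
      from integral_sphere_zonal[OF x[of i] d \<beta> this]
      show "(LINT w|sphere_measure. (g (x i \<bullet> w) - T N (x i \<bullet> w))\<^sup>2) = \<kappa> * V N"
        by (simp add: \<kappa>_def V_def)
    qed
    finally show ?thesis by simp
  qed
  have key: "(a k)\<^sup>2 * (LINT w|sphere_measure. (P k w)\<^sup>2)
      \<le> 2 * ((\<Sum>i\<in>UNIV. (c i)\<^sup>2) * (real CARD('m) * (\<kappa> * V N)))" if "k < N" for N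
  proof -
    have "(a k)\<^sup>2 * (LINT w|sphere_measure. (P k w)\<^sup>2) \<le> (\<Sum>k<N. (a k)\<^sup>2 * (LINT w|sphere_measure. (P k w)\<^sup>2))"
      using that by (intro member_le_sum) (auto intro!: mult_nonneg_nonneg)
    also have "\<dots> = (LINT w|sphere_measure. (R N w)\<^sup>2)" by (simp add: pyth)
    also have "\<dots> \<le> (LINT w|sphere_measure. 2 * (F w)\<^sup>2 + 2 * (E N w)\<^sup>2)"
    proof (rule integral_mono)
      fix w :: 'a assume "w \<in> space sphere_measure"
      then have "R N w = F w - E N w" by (intro RT) simp
      moreover have "0 \<le> (F w + E N w)\<^sup>2" by simp
      ultimately show "(R N w)\<^sup>2 \<le> 2 * (F w)\<^sup>2 + 2 * (E N w)\<^sup>2"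
        by (simp add: power2_sum power2_diff)
    qed (intro ints continuous_intros contR contF contE)+
    also have "\<dots> = 2 * (LINT w|sphere_measure. (F w)\<^sup>2) + 2 * (LINT w|sphere_measure. (E N w)\<^sup>2)"
      by (subst Bochner_Integration.integral_add, intro ints continuous_intros contF,
          intro ints continuous_intros contE) simp
    also have "\<dots> = 2 * (LINT w|sphere_measure. (E N w)\<^sup>2)"
      using zero by (simp add: F_def)
    finally show ?thesis using E_bound[of N] by linarith
  qed
  have "V \<longlonglongrightarrow> 0"
    using expansion by (simp add: V_def[abs_def] \<beta>_def T_def)
  then have "(\<lambda>N. 2 * ((\<Sum>i\<in>UNIV. (c i)\<^sup>2) * (real CARD('m) * (\<kappa> * V N)))) \<longlonglongrightarrow>
      2 * ((\<Sum>i\<in>UNIV. (c i)\<^sup>2) * (real CARD('m) * (\<kappa> * 0)))"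
    by (intro tendsto_intros)
  then have "(a k)\<^sup>2 * (LINT w|sphere_measure. (P k w)\<^sup>2) \<le>
      2 * ((\<Sum>i\<in>UNIV. (c i)\<^sup>2) * (real CARD('m) * (\<kappa> * 0)))"
    by (rule tendsto_lowerbound) (auto intro!: exI[of _ "Suc k"] key simp: eventually_sequentially Suc_le_eq)
  then have "(a k)\<^sup>2 * (LINT w|sphere_measure. (P k w)\<^sup>2) \<le> 0" by simp
  moreover have "0 \<le> (LINT w|sphere_measure. (P k w)\<^sup>2)" by (intro Bochner_Integration.integral_nonneg) simp
  ultimately have "(LINT w|sphere_measure. (P k w)\<^sup>2) = 0"
    using k by (auto simp: mult_le_0_iff)
  moreover have "homogeneous k (P k)"
    by (simp add: homogeneous_def P_def sum_distrib_left mult.left_commute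
        homogeneous_solid_gegenbauer[unfolded homogeneous_def, rule_format])
  ultimately have "P k y = 0"
    using homogeneous_eq_0_on_sphere[OF contP _ _ y] by blast
  then show ?thesis
    using y by (simp add: P_def solid_gegenbauer_sphere)
qed

text \<open>Up to a null sequence, the normalised relation at \<open>x j\<close> of degree \<open>k\<close> reads
  \<open>c j + (- 1) ^ k * s = 0\<close>, where \<open>s\<close> is the coefficient of the antipode of \<open>x j\<close>, or \<open>0\<close> if the
  antipode is not among the points.\<close>

lemma coefficients_zero:
  fixes x :: "'m::finite \<Rightarrow> 'a::real_inner"
  assumes \<tau>: "1 / 2 \<le> \<tau>" and x: "\<And>i. norm (x i) = 1" and inj: "inj x"
    and even: "infinite {k \<in> Z. even k}" and odd: "infinite {k \<in> Z. odd k}"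
    and zero: "\<And>k. k \<in> Z \<Longrightarrow> (\<Sum>i\<in>UNIV. c i * gegenbauer \<tau> k (x i \<bullet> x j)) = 0"
  shows "c j = 0"
proof -
  let ?n = "normalized_gegenbauer \<tau>"
  \<comment> \<open>The limiting behaviour of the normalised polynomials at \<open>x i \<bullet> x j\<close>.\<close>
  define b where "b = (\<lambda>i k. if i = j then 1 else if x i = - x j then (- 1) ^ k else (0::real))"
  define s where "s = (\<Sum>i\<in>UNIV. if i = j then 0 else if x i = - x j then c i else 0)"
  have pos: "0 < gegenbauer \<tau> k 1" for k using \<tau> by (intro gegenbauer_one_pos) simp
  have "(\<lambda>k. ?n (x i \<bullet> x j) k - b i k) \<longlonglongrightarrow> 0" for i
  proof -
    consider "i = j" | "i \<noteq> j" "x i = - x j" | "i \<noteq> j" "x i \<noteq> - x j" by blast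
    then show ?thesis
    proof cases
      case 1
      have "?n (x i \<bullet> x j) k - b i k = 0" for k
        using pos[of k] x[of j] 1 by (simp add: b_def normalized_gegenbauer_def dot_square_norm)
      then show ?thesis by simp
    next
      case 2
      have "?n (x i \<bullet> x j) k - b i k = 0" for k
        using pos[of k] x[of j] 2 by (simp add: b_def normalized_gegenbauer_def dot_square_norm gegenbauer_minus)
      then show ?thesis by simp
    next
      case 3
      have "x i \<noteq> x j" using inj 3 by (auto dest: injD)
      then have "\<bar>x i \<bullet> x j\<bar> \<noteq> 1"
        using 3 x[of i] x[of j] norm_cauchy_schwarz_abs_eq[of "x i" "x j"]
        by (auto simp: eq_neg_iff_add_eq_0 add.commute)
      moreover have "\<bar>x i \<bullet> x j\<bar> \<le> 1"
        using Cauchy_Schwarz_ineq2[of "x i" "x j"] x by simp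
      ultimately have "?n (x i \<bullet> x j) \<longlonglongrightarrow> 0"
        by (intro normalized_gegenbauer_tendsto_0 \<tau>) simp
      then show ?thesis using 3 by (simp add: b_def)
    qed
  qed
  then have "(\<lambda>k. \<Sum>i\<in>UNIV. c i * (?n (x i \<bullet> x j) k - b i k)) \<longlonglongrightarrow> (\<Sum>i\<in>UNIV. c i * 0)"
    by (intro tendsto_intros)
  then have r: "(\<lambda>k. \<Sum>i\<in>UNIV. c i * (?n (x i \<bullet> x j) k - b i k)) \<longlonglongrightarrow> 0" by simp
  have bs: "(\<Sum>i\<in>UNIV. c i * b i k) = c j + (- 1) ^ k * s" for k
  proof -
    have "(\<Sum>i\<in>UNIV. c i * b i k) = (\<Sum>i\<in>UNIV. (if i = j then c i else 0) +
        (- 1) ^ k * (if i = j then 0 else if x i = - x j then c i else 0))"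
      by (rule sum.cong) (auto simp: b_def)
    then show ?thesis by (simp add: sum.distrib s_def flip: sum_distrib_left)
  qed
  have rZ: "(\<Sum>i\<in>UNIV. c i * (?n (x i \<bullet> x j) k - b i k)) = - (c j + (- 1) ^ k * s)" if "k \<in> Z" for k
  proof -
    have "(\<Sum>i\<in>UNIV. c i * ?n (x i \<bullet> x j) k) = (\<Sum>i\<in>UNIV. c i * gegenbauer \<tau> k (x i \<bullet> x j)) / gegenbauer \<tau> k 1"
      by (simp add: normalized_gegenbauer_def sum_divide_distrib)
    then show ?thesis
      by (simp add: zero[OF that] right_diff_distrib sum_subtractf bs)
  qed
  have const: "v = 0" if "infinite Y" "\<And>k. k \<in> Y \<Longrightarrow> (\<Sum>i\<in>UNIV. c i * (?n (x i \<bullet> x j) k - b i k)) = v" for Y v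
  proof -
    have "(\<lambda>m. v) \<longlonglongrightarrow> 0"
      using LIMSEQ_subseq_LIMSEQ[OF r strict_mono_enumerate[OF that(1)]]
        that(2)[OF enumerate_in_set[OF that(1)]] by (simp add: o_def)
    then show ?thesis by (simp add: LIMSEQ_const_iff)
  qed
  have "- (c j + s) = 0" by (rule const[OF even]) (simp add: rZ)
  moreover have "- (c j - s) = 0" by (rule const[OF odd]) (simp add: rZ)
  ultimately show ?thesis by simp
qed

theorem theorem3p3:
  fixes \<gamma> :: "real \<Rightarrow> real"
    and a :: "nat \<Rightarrow> real"
    and x :: "'m::finite \<Rightarrow> real ^ 'd"
  assumes "3 \<le> CARD('d)"
    and "\<exists>L. L-lipschitz_on {-1..1} \<gamma>"
    and "ultraspherical_expansion ((real CARD('d) - 2) / 2) \<gamma> a"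
    and "infinite {k. a k \<noteq> 0 \<and> odd k}"
    and "infinite {k. a k \<noteq> 0 \<and> even k}"
    and "\<And>i. x i \<in> sphere 0 1"
    and "inj x"
  shows "strictly_positive_definite
    (\<chi> i j. 1 / measure sphere_measure (sphere (0 :: real ^ 'd) 1) *
      (LINT w|sphere_measure. \<gamma> (x i \<bullet> w) * \<gamma> (w \<bullet> x j)))"
proof -
  define \<tau> where "\<tau> = (real DIM(real ^ 'd) - 2) / 2"
  have dim: "3 \<le> DIM(real ^ 'd)" using assms(1) by simp
  have \<tau>: "1 / 2 \<le> \<tau>" using assms(1) by (simp add: \<tau>_def)
  have x: "norm (x i) = 1" for i using assms(6)[of i] by simp
  \<comment> \<open>Nothing is known about \<open>\<gamma>\<close> outside \<open>[-1,1]\<close>; the constant extension is continuous everywhere.\<close>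
  define g where "g = (\<lambda>t. \<gamma> (max (- 1) (min 1 t)))"
  have g_eq: "g t = \<gamma> t" if "\<bar>t\<bar> \<le> 1" for t
    using that by (auto simp: g_def min_def max_def abs_le_iff)
  have "continuous_on {-1..1} \<gamma>"
    using assms(2) lipschitz_on_continuous_on by blast
  then have g: "continuous_on UNIV g"
    unfolding g_def by (rule continuous_on_compose2) (auto intro!: continuous_intros)
  define I where "I = (\<lambda>i j. LINT w|sphere_measure. g (x i \<bullet> w) * g (x j \<bullet> w))"
  define M where "M = measure sphere_measure (sphere (0 :: real ^ 'd) 1)"
  have M: "0 < M" unfolding M_def by (rule measure_sphere_pos)
  have entry: "(LINT w|sphere_measure. \<gamma> (x i \<bullet> w) * \<gamma> (w \<bullet> x j)) = I i j" for i j
    unfolding I_def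
  proof (rule integral_sphere_measure_cong)
    fix w :: "real ^ 'd" assume w: "norm w = 1"
    have "\<bar>x i \<bullet> w\<bar> \<le> 1" for i
      using Cauchy_Schwarz_ineq2[of "x i" w] x w by simp
    then show "\<gamma> (x i \<bullet> w) * \<gamma> (w \<bullet> x j) = g (x i \<bullet> w) * g (x j \<bullet> w)"
      by (simp add: g_eq inner_commute)
  qed
  have expansion: "(\<lambda>N. gegenbauer_weight_integral (\<tau> - 1 / 2)
       (\<lambda>t. (g t - (\<Sum>k<N. a k * gegenbauer \<tau> k t))\<^sup>2)) \<longlonglongrightarrow> 0"
  proof -
    have "gegenbauer_weight_integral (\<tau> - 1 / 2) (\<lambda>t. (g t - (\<Sum>k<N. a k * gegenbauer \<tau> k t))\<^sup>2) =
       (LINT t:{-1..1}|lborel. (\<gamma> t - (\<Sum>k<N. a k * gegenbauer \<tau> k t))\<^sup>2 * (1 - t\<^sup>2) powr (\<tau> - 1/2))" for N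
      unfolding gegenbauer_weight_integral_def
      by (rule set_lebesgue_integral_cong) (auto simp: g_eq)
    moreover have "(real CARD('d) - 2) / 2 = \<tau>" by (simp add: \<tau>_def)
    ultimately show ?thesis
      using assms(3) by (simp only: ultraspherical_expansion_def)
  qed
  have quad: "c \<bullet> ((\<chi> i j. 1 / M * I i j) *v c) =
      (LINT w|sphere_measure. (\<Sum>i\<in>UNIV. c $ i * g (x i \<bullet> w))\<^sup>2) / M" for c :: "real ^ 'm"
  proof -
    have compose: "continuous_on UNIV (\<lambda>w. g (x i \<bullet> w))" for i
      by (rule continuous_on_compose2[OF g]) (auto intro!: continuous_intros)
    note ints = integrable_sphere_measure[where 'a="real ^ 'd"]
    have "(LINT w|sphere_measure. (\<Sum>i\<in>UNIV. c $ i * g (x i \<bullet> w))\<^sup>2) =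
        (LINT w|sphere_measure. (\<Sum>i\<in>UNIV. \<Sum>j\<in>UNIV. (c $ i * c $ j) * (g (x i \<bullet> w) * g (x j \<bullet> w))))"
      by (simp add: power2_eq_square sum_product mult_ac)
    also have "\<dots> = (\<Sum>i\<in>UNIV. LINT w|sphere_measure. (\<Sum>j\<in>UNIV. (c $ i * c $ j) * (g (x i \<bullet> w) * g (x j \<bullet> w))))"
      by (intro Bochner_Integration.integral_sum ints continuous_intros compose)
    also have "\<dots> = (\<Sum>i\<in>UNIV. \<Sum>j\<in>UNIV. LINT w|sphere_measure. (c $ i * c $ j) * (g (x i \<bullet> w) * g (x j \<bullet> w)))"
      by (intro sum.cong refl Bochner_Integration.integral_sum ints continuous_intros compose)
    also have "\<dots> = (\<Sum>i\<in>UNIV. \<Sum>j\<in>UNIV. (c $ i * c $ j) * I i j)"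
      by (simp add: I_def)
    finally show ?thesis
      by (simp add: inner_vec_def matrix_vector_mult_def sum_distrib_left sum_divide_distrib mult_ac)
  qed
  show ?thesis
    unfolding strictly_positive_definite_def entry M_def[symmetric]
  proof (intro conjI allI impI)
    show "transpose (\<chi> i j. 1 / M * I i j) = (\<chi> i j. 1 / M * I i j)"
      by (simp add: transpose_def vec_eq_iff I_def mult.commute)
  next
    fix c :: "real ^ 'm" assume c: "c \<noteq> 0"
    let ?q = "LINT w|sphere_measure. (\<Sum>i\<in>UNIV. c $ i * g (x i \<bullet> w))\<^sup>2"
    have "?q \<noteq> 0"
    proof
      assume q: "?q = 0"
      have "c $ j = 0" for j
      proof (rule coefficients_zero[OF \<tau> x assms(7), where Z="{k. a k \<noteq> 0}" and c="\<lambda>i. c $ i"])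
        show "infinite {k \<in> {k. a k \<noteq> 0}. even k}" "infinite {k \<in> {k. a k \<noteq> 0}. odd k}"
          using assms(4,5) by simp_all
        show "(\<Sum>i\<in>UNIV. c $ i * gegenbauer \<tau> k (x i \<bullet> x j)) = 0" if "k \<in> {k. a k \<noteq> 0}" for k
          using zonal_combination_components_vanish[OF dim \<tau>_def g expansion x q _ x] that by simp
      qed
      then show False using c by (simp add: vec_eq_iff)
    qed
    moreover have "0 \<le> ?q" by (intro Bochner_Integration.integral_nonneg) simp
    ultimately show "0 < c \<bullet> ((\<chi> i j. 1 / M * I i j) *v c)"
      unfolding quad using M by (intro divide_pos_pos) linarith+
  qed
qed

end
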